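(* Let $0<\delta<1/2$ and let $\epsilon_1,\epsilon_2,\ldots$ be a sequence of random variables such that $E\epsilon_i=0$ for all $1\le i<\infty$ and such that there is $\sigma>0$ for which $$n^{-1/2}\sum_{1\le i\le nt}\epsilon_i \xrightarrow{\mathcal{D}[0,1]} \sigma W(t)\qquad (n\to\infty),$$ where $\{W(t),0\le t<\infty\}$ is a Wiener process. Suppose the alternative $H_A^{**}$ holds: there is $1\le k^*<n$ such that the observations $X_1,\ldots,X_n$ satisfy $$X_k=\begin{cases}\mu+\epsilon_{k^*}+\cdots+\epsilon_k, & 1\le k\le k^*,\\ \mu+\epsilon_k, & k^*<k\le n.\end{cases}$$ Assume that $k^*=[n\theta]$ with some $0<\theta<1$ and that $\delta<\theta<1-\delta$. Then, as $n\to\infty$, $$V_{n,i}\xrightarrow{P}\infty,\qquad i=1,2,3.$$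
   Context: $\xrightarrow{\mathcal{D}[0,1]}$ denotes weak convergence in the Skorokhod space $\mathcal{D}[0,1]$; $\xrightarrow{P}\infty$ means divergence to infinity in probability; $[x]$ is the integer part of $x$. The change-point condition is understood for $n$ large enough that $1\le[n\theta]<n$. Here $\mu$ is a real constant, and for $1\le k\le k^*$ the expression $\epsilon_{k^*}+\cdots+\epsilon_k$ means $\sum_{j=k}^{k^*}\epsilon_j$. In all maxima, $k$, $i$ are integers. Partial means: $\bar X_k=\frac1k\sum_{1\le i\le k}X_i$ and $\tilde X_k=\frac{1}{n-k}\sum_{k<i\le n}X_i$. Test statistics: $$V_{n,1}=\max_{n\delta\le k\le n-n\delta}\frac{\max_{1\le i\le k}\left|\sum_{1\le j\le i}(X_j-\bar X_k)\right|}{\max_{k\le i\le n}\left|\sum_{i\le j\le n}(X_j-\tilde X_k)\right|},$$ $$V_{n,2}=\max_{n\delta\le k\le n-n\delta}\frac{\max_{1\le i\le k}\sum_{1\le j\le i}(X_j-\bar X_k)-\min_{1\le i\le k}\sum_{1\le j\le i}(X_j-\bar X_k)}{\max_{k<i\le n}\sum_{i\le j\le n}(X_j-\tilde X_k)-\min_{k<i\le n}\sum_{i\le j\le n}(X_j-\tilde X_k)},$$ $$V_{n,3}=\max_{n\delta\le k\le n-n\delta}\frac{\sum_{i=1}^{k}\left[\sum_{j=1}^{i}(X_j-\bar X_k)\right]^2-\frac1k\left[\sum_{i=1}^{k}\sum_{j=1}^{i}(X_j-\bar X_k)\right]^2}{\sum_{i=k+1}^{n}\left[\sum_{j=i}^{n}(X_j-\tilde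 X_k)\right]^2-\frac1{n-k}\left[\sum_{i=k+1}^{n}\sum_{j=i}^{n}(X_j-\tilde X_k)\right]^2}.$$ *)

theory Defs
  imports "HOL-Probability.Probability"
begin

section \<open>The Skorokhod space \<open>D[0,1]\<close>\<close>

text \<open>
  Elements are total functions that are \<^const>\<open>undefined\<close> outside \<open>[0,1]\<close>, so that
  functions agreeing on \<open>[0,1]\<close> are equal.
\<close>

definition cadlag01 :: "(real \<Rightarrow> real) set" where
  "cadlag01 = {x \<in> extensional {0..1}.
     (\<forall>t\<in>{0..<1}. (x \<longlongrightarrow> x t) (at_right t)) \<and>
     (\<forall>t\<in>{0<..1}. \<exists>l. (x \<longlongrightarrow> l) (at_left t))}"

definition time_changes :: "(real \<Rightarrow> real) set" where
  "time_changes = {l. continuous_on {0..1} l \<and> strict_mono_on {0..1} l \<and> l ` {0..1} = {0..1}}"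

text \<open>
  Skorokhod's \<open>J1\<close> metric, in Billingsley's form (the one without the logarithmic slope condition).
  The value \<open>0\<close> off \<^const>\<open>cadlag01\<close> is arbitrary; \<^locale>\<open>Metric_space\<close> asks for a distance
  that is nonnegative everywhere.
\<close>

definition skorokhod_close :: "(real \<Rightarrow> real) \<Rightarrow> (real \<Rightarrow> real) \<Rightarrow> real \<Rightarrow> bool" where
  "skorokhod_close x y e \<longleftrightarrow> 0 < e \<and>
     (\<exists>l\<in>time_changes. \<forall>t\<in>{0..1}. \<bar>l t - t\<bar> \<le> e \<and> \<bar>x t - y (l t)\<bar> \<le> e)"

definition skorokhod_dist :: "(real \<Rightarrow> real) \<Rightarrow> (real \<Rightarrow> real) \<Rightarrow> real" where
  "skorokhod_dist x y =
     (if x \<in> cadlag01 \<and> y \<in> cadlag01 then Inf {e. skorokhod_close x y e} else 0)"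

definition skorokhod_topology :: "(real \<Rightarrow> real) topology" where
  "skorokhod_topology = Metric_space.mtopology cadlag01 skorokhod_dist"

definition skorokhod_borel :: "(real \<Rightarrow> real) measure" where
  "skorokhod_borel = sigma cadlag01 {U. openin skorokhod_topology U}"

lemma time_changes_id: "(\<lambda>t. t) \<in> time_changes"
  by (auto simp: time_changes_def strict_mono_on_def)

lemma time_changes_maps: "l \<in> time_changes \<Longrightarrow> t \<in> {0..1} \<Longrightarrow> l t \<in> {0..1}"
  by (auto simp: time_changes_def)

lemma time_changes_one:
  assumes l: "l \<in> time_changes" shows "l 1 = 1"
proof -
  have "1 \<in> l ` {0..1}" using l by (simp add: time_changes_def)
  then obtain s where s: "s \<in> {0..1}" "l s = 1" by auto
  have "l s \<le> l 1"
    using l s by (intro strict_mono_on_leD[of "{0..1}" l]) (auto simp: time_changes_def)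
  with s time_changes_maps[OF l, of 1] show ?thesis by auto
qed

lemma time_changes_compose:
  assumes "l \<in> time_changes" "m \<in> time_changes"
  shows "(\<lambda>t. m (l t)) \<in> time_changes"
proof -
  have "continuous_on {0..1} (m \<circ> l)"
    using assms by (intro continuous_on_compose) (auto simp: time_changes_def)
  moreover have "(\<lambda>t. m (l t)) ` {0..1} = m ` (l ` {0..1})" by auto
  moreover have "strict_mono_on {0..1} (\<lambda>t. m (l t))"
    using assms time_changes_maps[OF assms(1)]
    by (auto simp: time_changes_def strict_mono_on_def)
  ultimately show ?thesis
    using assms by (auto simp: time_changes_def o_def)
qed

lemma time_changes_inverse:
  assumes l: "l \<in> time_changes"
  shows "inv_into {0..1} l \<in> time_changes"
proof -
  have inj: "inj_on l {0..1}"
    using l by (auto simp: time_changes_def strict_mono_on_imp_inj_on)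
  have img: "l ` {0..1} = {0..1}" using l by (simp add: time_changes_def)
  have "continuous_on (l ` {0..1}) (inv_into {0..1} l)"
    using l inj by (intro continuous_on_inv) (auto simp: time_changes_def)
  moreover have "strict_mono_on {0..1} (inv_into {0..1} l)"
  proof (rule strict_mono_onI)
    fix r s :: real assume rs: "r \<in> {0..1}" "s \<in> {0..1}" "r < s"
    let ?r = "inv_into {0..1} l r" and ?s = "inv_into {0..1} l s"
    have in01: "?r \<in> {0..1}" "?s \<in> {0..1}"
      using rs img inv_into_into[of _ l "{0..1}"] by blast+
    have eq: "l ?r = r" "l ?s = s"
      using rs img f_inv_into_f[of _ l "{0..1}"] by blast+
    show "?r < ?s"
    proof (rule ccontr)
      assume "\<not> ?r < ?s"
      then have "l ?s \<le> l ?r"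
        using l in01 by (intro strict_mono_on_leD[of "{0..1}" l]) (auto simp: time_changes_def)
      with eq rs show False by simp
    qed
  qed
  moreover have "inv_into {0..1} l ` {0..1} = {0..1}"
    using inv_into_image_cancel[OF inj, of "{0..1}"] img by simp
  ultimately show ?thesis using img by (simp add: time_changes_def)
qed

lemma cadlag01_locally_bounded:
  assumes x: "x \<in> cadlag01" and t: "t \<in> {0..1}"
  shows "\<exists>U B. open U \<and> t \<in> U \<and> (\<forall>s\<in>U \<inter> {0..1}. \<bar>x s\<bar> \<le> B)"
proof -
  have right: "\<exists>h>t. \<exists>B. \<forall>s. t < s \<longrightarrow> s < h \<longrightarrow> s \<le> 1 \<longrightarrow> \<bar>x s\<bar> \<le> B"
  proof (cases "t = 1")
    case True then show ?thesis by (intro exI[of _ 2]) auto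
  next
    case False
    then have "(x \<longlongrightarrow> x t) (at_right t)" using x t by (auto simp: cadlag01_def)
    then have "eventually (\<lambda>s. dist (x s) (x t) < 1) (at_right t)"
      by (rule tendstoD) simp
    then obtain h where "h > t" "\<forall>s>t. s < h \<longrightarrow> dist (x s) (x t) < 1"
      by (auto simp: eventually_at_right_field)
    then show ?thesis
      by (intro exI[of _ h] conjI exI[of _ "\<bar>x t\<bar> + 1"]) (force simp: dist_real_def)+
  qed
  have left: "\<exists>h<t. \<exists>B. \<forall>s. h < s \<longrightarrow> s < t \<longrightarrow> 0 \<le> s \<longrightarrow> \<bar>x s\<bar> \<le> B"
  proof (cases "t = 0")
    case True then show ?thesis by (intro exI[of _ "-1"]) auto
  next
    case False
    then obtain l where "(x \<longlongrightarrow> l) (at_left t)" using x t by (force simp: cadlag01_def)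
    then have "eventually (\<lambda>s. dist (x s) l < 1) (at_left t)"
      by (rule tendstoD) simp
    then obtain h where "h < t" "\<forall>s>h. s < t \<longrightarrow> dist (x s) l < 1"
      by (auto simp: eventually_at_left_field)
    then show ?thesis
      by (intro exI[of _ h] conjI exI[of _ "\<bar>l\<bar> + 1"]) (force simp: dist_real_def)+
  qed
  obtain h B where h: "h > t" "\<And>s. t < s \<Longrightarrow> s < h \<Longrightarrow> s \<le> 1 \<Longrightarrow> \<bar>x s\<bar> \<le> B"
    using right by blast
  obtain h' B' where h': "h' < t" "\<And>s. h' < s \<Longrightarrow> s < t \<Longrightarrow> 0 \<le> s \<Longrightarrow> \<bar>x s\<bar> \<le> B'"
    using left by blast
  have "\<bar>x s\<bar> \<le> max \<bar>x t\<bar> (max B B')" if "s \<in> {h'<..<h} \<inter> {0..1}" for s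
    using that h(2)[of s] h'(2)[of s] by (cases s t rule: linorder_cases) (auto simp: le_max_iff_disj)
  with h(1) h'(1) show ?thesis
    by (intro exI[of _ "{h'<..<h}"] exI[of _ "max \<bar>x t\<bar> (max B B')"]) auto
qed

lemma cadlag01_bounded:
  assumes x: "x \<in> cadlag01"
  shows "\<exists>B. \<forall>t\<in>{0..1}. \<bar>x t\<bar> \<le> B"
proof -
  obtain U B where UB: "\<And>t. t \<in> {0..1} \<Longrightarrow> open (U t) \<and> t \<in> U t \<and> (\<forall>s\<in>U t \<inter> {0..1}. \<bar>x s\<bar> \<le> B t)"
    using cadlag01_locally_bounded[OF x] by metis
  have "compact {0..1::real}" by simp
  then obtain C where C: "C \<subseteq> {0..1}" "finite C" "{0..1} \<subseteq> (\<Union>t\<in>C. U t)"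
    by (rule compactE_image[where C = "{0..1}" and f = U]) (use UB in auto)
  have "\<bar>x s\<bar> \<le> (\<Sum>t\<in>C. \<bar>B t\<bar>)" if s: "s \<in> {0..1}" for s
  proof -
    obtain t where t: "t \<in> C" "s \<in> U t" using C(3) s by auto
    then have "\<bar>x s\<bar> \<le> \<bar>B t\<bar>" using UB[of t] C(1) s by force
    also have "\<dots> \<le> (\<Sum>t\<in>C. \<bar>B t\<bar>)" using t C(2) by (intro member_le_sum) auto
    finally show ?thesis .
  qed
  then show ?thesis by blast
qed

lemma skorokhod_close_exists:
  assumes "x \<in> cadlag01" "y \<in> cadlag01"
  shows "\<exists>e. skorokhod_close x y e"
proof -
  obtain B where B: "\<And>t. t \<in> {0..1} \<Longrightarrow> \<bar>x t\<bar> \<le> B" using cadlag01_bounded assms by blast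
  obtain C where C: "\<And>t. t \<in> {0..1} \<Longrightarrow> \<bar>y t\<bar> \<le> C" using cadlag01_bounded assms by blast
  have "\<bar>x t - y t\<bar> \<le> B + C" if "t \<in> {0..1}" for t using B[OF that] C[OF that] by linarith
  moreover have "0 \<le> B + C" using calculation[of 0] by auto
  ultimately have "skorokhod_close x y (B + C + 1)"
    unfolding skorokhod_close_def
    by (intro conjI bexI[OF _ time_changes_id]) (auto simp: add_increasing2)
  then show ?thesis ..
qed

lemma skorokhod_close_sym:
  assumes "skorokhod_close x y e" shows "skorokhod_close y x e"
proof -
  obtain l where l: "l \<in> time_changes" and e: "0 < e"
    and cl: "\<And>t. t \<in> {0..1} \<Longrightarrow> \<bar>l t - t\<bar> \<le> e \<and> \<bar>x t - y (l t)\<bar> \<le> e"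
    using assms by (auto simp: skorokhod_close_def)
  let ?m = "inv_into {0..1} l"
  have m: "?m \<in> time_changes" using l by (rule time_changes_inverse)
  have "\<bar>?m t - t\<bar> \<le> e \<and> \<bar>y t - x (?m t)\<bar> \<le> e" if t: "t \<in> {0..1}" for t
  proof -
    have "l (?m t) = t" using t l by (intro f_inv_into_f) (simp add: time_changes_def)
    with cl[OF time_changes_maps[OF m t]] show ?thesis by (simp add: abs_minus_commute)
  qed
  with m e show ?thesis unfolding skorokhod_close_def by blast
qed

lemma skorokhod_close_trans:
  assumes "skorokhod_close x y e" "skorokhod_close y z f"
  shows "skorokhod_close x z (e + f)"
proof -
  obtain l where l: "l \<in> time_changes" and e: "0 < e"
    and cl: "\<And>t. t \<in> {0..1} \<Longrightarrow> \<bar>l t - t\<bar> \<le> e \<and> \<bar>x t - y (l t)\<bar> \<le> e"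
    using assms(1) by (auto simp: skorokhod_close_def)
  obtain m where m: "m \<in> time_changes" and f: "0 < f"
    and cm: "\<And>t. t \<in> {0..1} \<Longrightarrow> \<bar>m t - t\<bar> \<le> f \<and> \<bar>y t - z (m t)\<bar> \<le> f"
    using assms(2) by (auto simp: skorokhod_close_def)
  have "\<bar>m (l t) - t\<bar> \<le> e + f \<and> \<bar>x t - z (m (l t))\<bar> \<le> e + f" if t: "t \<in> {0..1}" for t
    using cl[OF t] cm[OF time_changes_maps[OF l t]] by linarith
  with time_changes_compose[OF l m] e f show ?thesis by (force simp: skorokhod_close_def)
qed

lemma skorokhod_dist_less_iff:
  assumes "x \<in> cadlag01" "y \<in> cadlag01"
  shows "skorokhod_dist x y < r \<longleftrightarrow> (\<exists>e<r. skorokhod_close x y e)"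
proof -
  have "bdd_below {e. skorokhod_close x y e}"
    by (rule bdd_belowI[of _ 0]) (auto simp: skorokhod_close_def)
  then show ?thesis
    using skorokhod_close_exists[OF assms] assms unfolding skorokhod_dist_def
    by (simp add: cInf_less_iff) blast
qed

lemma skorokhod_dist_zero_imp_eq:
  assumes x: "x \<in> cadlag01" and y: "y \<in> cadlag01" and d: "skorokhod_dist x y = 0"
  shows "x = y"
proof -
  have close: "\<exists>l\<in>time_changes. \<forall>t\<in>{0..1}. \<bar>l t - t\<bar> < r \<and> \<bar>x t - y (l t)\<bar> < r" if "r > 0" for r
  proof -
    have "skorokhod_dist x y < r" using d that by simp
    then obtain e where "e < r" "skorokhod_close x y e"
      using skorokhod_dist_less_iff[OF x y] by blast
    then show ?thesis unfolding skorokhod_close_def by (meson le_less_trans)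
  qed
  have "x t = y t" if t: "t \<in> {0..1}" for t
  proof (cases "t = 1")
    case True
    show ?thesis
    proof (rule ccontr)
      assume "x t \<noteq> y t"
      then have "0 < \<bar>x t - y t\<bar>" by simp
      from close[OF this] obtain l where "l \<in> time_changes" "\<bar>x t - y (l t)\<bar> < \<bar>x t - y t\<bar>"
        using t by blast
      with time_changes_one[of l] True show False by simp
    qed
  next
    case False
    with t have t1: "t \<in> {0..<1}" by auto
    have lim: "(x \<longlongrightarrow> x t) (at_right t)" "(y \<longlongrightarrow> y t) (at_right t)"
      using x y t1 by (auto simp: cadlag01_def)
    have "(x \<longlongrightarrow> y t) (at_right t)"
    proof (rule tendstoI)
      fix e :: real assume e: "0 < e"
      have "eventually (\<lambda>s. dist (y s) (y t) < e/2) (at_right t)"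
        using lim(2) e by (intro tendstoD) auto
      then obtain h where h: "h > t" "\<And>s. t < s \<Longrightarrow> s < h \<Longrightarrow> dist (y s) (y t) < e/2"
        by (auto simp: eventually_at_right_field)
      show "eventually (\<lambda>s. dist (x s) (y t) < e) (at_right t)"
        unfolding eventually_at_right_field
      proof (intro exI[of _ "min h 1"] conjI allI impI)
        show "t < min h 1" using h t1 by auto
        fix s assume s: "t < s" "s < min h 1"
        have "0 < min (e/2) (min (s - t) (h - s))" using e s by auto
        from close[OF this] obtain l where
          l: "\<forall>u\<in>{0..1}. \<bar>l u - u\<bar> < min (e/2) (min (s - t) (h - s)) \<and>
                          \<bar>x u - y (l u)\<bar> < min (e/2) (min (s - t) (h - s))" by blast
        have "s \<in> {0..1}" using s t1 by auto
        with l have ls: "\<bar>l s - s\<bar> < min (s - t) (h - s)" "\<bar>x s - y (l s)\<bar> < e/2" by auto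
        then have "dist (y (l s)) (y t) < e/2" by (intro h(2)) auto
        with ls show "dist (x s) (y t) < e" unfolding dist_real_def by linarith
      qed
    qed
    with lim(1) show ?thesis
      by (intro tendsto_unique[of "at_right t"]) (auto simp: trivial_limit_at_right_real)
  qed
  then show ?thesis
    using x y by (intro extensionalityI[of _ "{0..1}"]) (auto simp: cadlag01_def)
qed

lemma Metric_space_skorokhod: "Metric_space cadlag01 skorokhod_dist"
proof
  show nonneg: "0 \<le> skorokhod_dist x y" for x y
  proof (cases "x \<in> cadlag01 \<and> y \<in> cadlag01")
    case True
    then have "{e. skorokhod_close x y e} \<noteq> {}" using skorokhod_close_exists[of x y] by auto
    then have "0 \<le> Inf {e. skorokhod_close x y e}"
      by (rule cInf_greatest) (simp add: skorokhod_close_def)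
    with True show ?thesis by (simp add: skorokhod_dist_def)
  qed (auto simp: skorokhod_dist_def)
  show "skorokhod_dist x y = skorokhod_dist y x" for x y
  proof -
    have "{e. skorokhod_close x y e} = {e. skorokhod_close y x e}"
      by (auto intro: skorokhod_close_sym)
    then show ?thesis by (auto simp: skorokhod_dist_def)
  qed
  fix x y z assume x: "x \<in> cadlag01" and y: "y \<in> cadlag01"
  show "skorokhod_dist x y = 0 \<longleftrightarrow> x = y"
  proof
    assume "x = y"
    have le: "skorokhod_dist x x \<le> e" if "e > 0" for e
    proof -
      have "skorokhod_close x x (e/2)"
        using that by (auto simp: skorokhod_close_def intro!: bexI[OF _ time_changes_id])
      moreover have "e/2 < e" using that by simp
      ultimately have "skorokhod_dist x x < e" using skorokhod_dist_less_iff[OF x x] by blast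
      then show ?thesis by simp
    qed
    have "skorokhod_dist x x \<le> 0" by (rule field_le_epsilon) (simp add: le)
    with nonneg[of x x] \<open>x = y\<close> show "skorokhod_dist x y = 0" by simp
  qed (rule skorokhod_dist_zero_imp_eq[OF x y])
  assume z: "z \<in> cadlag01"
  show "skorokhod_dist x z \<le> skorokhod_dist x y + skorokhod_dist y z"
  proof (rule field_le_epsilon)
    fix r :: real assume r: "0 < r"
    have "skorokhod_dist x y < skorokhod_dist x y + r/2"
      "skorokhod_dist y z < skorokhod_dist y z + r/2" using r by auto
    then obtain e f where "e < skorokhod_dist x y + r/2" "skorokhod_close x y e"
      "f < skorokhod_dist y z + r/2" "skorokhod_close y z f"
      using skorokhod_dist_less_iff[OF x y] skorokhod_dist_less_iff[OF y z] by blast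
    then have "skorokhod_close x z (e + f)" "e + f < skorokhod_dist x y + skorokhod_dist y z + r"
      using skorokhod_close_trans by auto
    then show "skorokhod_dist x z \<le> skorokhod_dist x y + skorokhod_dist y z + r"
      using skorokhod_dist_less_iff[OF x z] less_imp_le by blast
  qed
qed

text \<open>
  The left-hand processes share one probability space; the limit may live on another.
  Measurability of the processes as random elements of \<open>D[0,1]\<close> is no extra restriction for cadlag
  processes with measurable coordinates, since the coordinate projections generate the Borel sets.
\<close>

definition skorokhod_weak_conv ::
    "'a measure \<Rightarrow> (nat \<Rightarrow> 'a \<Rightarrow> real \<Rightarrow> real) \<Rightarrow> 'b measure \<Rightarrow> ('b \<Rightarrow> real \<Rightarrow> real) \<Rightarrow> bool" where
  "skorokhod_weak_conv M Y N Z \<longleftrightarrow>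
     (\<forall>n. Y n \<in> M \<rightarrow>\<^sub>M skorokhod_borel) \<and> Z \<in> N \<rightarrow>\<^sub>M skorokhod_borel \<and>
     (\<forall>f :: (real \<Rightarrow> real) \<Rightarrow> real.
        continuous_map skorokhod_topology euclideanreal f \<longrightarrow> bounded (f ` cadlag01) \<longrightarrow>
        (\<lambda>n. \<integral>\<omega>. f (Y n \<omega>) \<partial>M) \<longlonglongrightarrow> (\<integral>\<omega>. f (Z \<omega>) \<partial>N))"


section \<open>Processes\<close>

definition wiener_process :: "'b measure \<Rightarrow> (real \<Rightarrow> 'b \<Rightarrow> real) \<Rightarrow> bool" where
  "wiener_process N W \<longleftrightarrow>
     prob_space N \<and>
     (\<forall>t\<ge>0. W t \<in> borel_measurable N) \<and>
     (AE \<omega> in N. W 0 \<omega> = 0) \<and>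
     (\<forall>\<omega>\<in>space N. continuous_on {0..} (\<lambda>t. W t \<omega>)) \<and>
     (\<forall>s t. 0 \<le> s \<longrightarrow> s < t \<longrightarrow>
        distributed N lborel (\<lambda>\<omega>. W t \<omega> - W s \<omega>) (normal_density 0 (sqrt (t - s)))) \<and>
     (\<forall>(t :: nat \<Rightarrow> real) m. 0 \<le> t 0 \<longrightarrow> (\<forall>i<m. t i \<le> t (Suc i)) \<longrightarrow>
        prob_space.indep_vars N (\<lambda>_. borel) (\<lambda>i \<omega>. W (t (Suc i)) \<omega> - W (t i) \<omega>) {..<m})"

definition scaled_partial_sums :: "(nat \<Rightarrow> 'a \<Rightarrow> real) \<Rightarrow> nat \<Rightarrow> 'a \<Rightarrow> real \<Rightarrow> real" where
  "scaled_partial_sums \<epsilon> n \<omega> =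
     (\<lambda>t\<in>{0..1}. (\<Sum>i | 1 \<le> i \<and> real i \<le> real n * t. \<epsilon> i \<omega>) / sqrt (real n))"

definition diverges_in_probability :: "'a measure \<Rightarrow> (nat \<Rightarrow> 'a \<Rightarrow> real) \<Rightarrow> bool" where
  "diverges_in_probability M Y \<longleftrightarrow>
     (\<forall>C. (\<lambda>n. measure M {\<omega> \<in> space M. C < Y n \<omega>}) \<longlonglongrightarrow> 1)"


section \<open>Change-point alternative and test statistics\<close>

text \<open>Up to time \<open>k*\<close> the errors accumulate backwards from \<open>k*\<close>, giving a random walk in \<open>k* - k\<close>.\<close>

definition change_alternative ::
    "'a measure \<Rightarrow> (nat \<Rightarrow> 'a \<Rightarrow> real) \<Rightarrow> real \<Rightarrow> nat \<Rightarrow> nat \<Rightarrow> (nat \<Rightarrow> 'a \<Rightarrow> real) \<Rightarrow> bool" where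
  "change_alternative M \<epsilon> \<mu> n kstar X \<longleftrightarrow> 1 \<le> kstar \<and> kstar < n \<and>
     (\<forall>\<omega>\<in>space M. \<forall>k\<in>{1..n}.
        X k \<omega> = (if k \<le> kstar then \<mu> + (\<Sum>j=k..kstar. \<epsilon> j \<omega>) else \<mu> + \<epsilon> k \<omega>))"

text \<open>
  The statistics are functions of one sample \<open>x 1, \<dots>, x n\<close>.  A ratio with vanishing denominator
  counts as \<open>0\<close>, so it can only make a statistic smaller than under the convention \<open>a / 0 = \<infinity>\<close>.
  For small \<open>n\<close> there may be no admissible \<open>k\<close>, and the maximum is then unspecified.
\<close>

definition split_points :: "real \<Rightarrow> nat \<Rightarrow> nat set" where
  "split_points \<delta> n = {k. real n * \<delta> \<le> real k \<and> real k \<le> real n - real n * \<delta>}"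

definition head_mean :: "(nat \<Rightarrow> real) \<Rightarrow> nat \<Rightarrow> real" where
  "head_mean x k = (\<Sum>i=1..k. x i) / real k"

definition tail_mean :: "(nat \<Rightarrow> real) \<Rightarrow> nat \<Rightarrow> nat \<Rightarrow> real" where
  "tail_mean x n k = (\<Sum>i\<in>{k<..n}. x i) / (real n - real k)"

definition head_sum :: "(nat \<Rightarrow> real) \<Rightarrow> nat \<Rightarrow> nat \<Rightarrow> real" where
  "head_sum x k i = (\<Sum>j=1..i. x j - head_mean x k)"

definition tail_sum :: "(nat \<Rightarrow> real) \<Rightarrow> nat \<Rightarrow> nat \<Rightarrow> nat \<Rightarrow> real" where
  "tail_sum x n k i = (\<Sum>j=i..n. x j - tail_mean x n k)"

definition V1 :: "real \<Rightarrow> nat \<Rightarrow> (nat \<Rightarrow> real) \<Rightarrow> real" where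
  "V1 \<delta> n x = (MAX k\<in>split_points \<delta> n.
     (MAX i\<in>{1..k}. \<bar>head_sum x k i\<bar>) / (MAX i\<in>{k..n}. \<bar>tail_sum x n k i\<bar>))"

definition V2 :: "real \<Rightarrow> nat \<Rightarrow> (nat \<Rightarrow> real) \<Rightarrow> real" where
  "V2 \<delta> n x = (MAX k\<in>split_points \<delta> n.
     ((MAX i\<in>{1..k}. head_sum x k i) - (MIN i\<in>{1..k}. head_sum x k i)) /
     ((MAX i\<in>{k<..n}. tail_sum x n k i) - (MIN i\<in>{k<..n}. tail_sum x n k i)))"

definition V3 :: "real \<Rightarrow> nat \<Rightarrow> (nat \<Rightarrow> real) \<Rightarrow> real" where
  "V3 \<delta> n x = (MAX k\<in>split_points \<delta> n.
     ((\<Sum>i=1..k. (head_sum x k i)\<^sup>2) - 1 / real k * (\<Sum>i=1..k. head_sum x k i)\<^sup>2) /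
     ((\<Sum>i=k+1..n. (tail_sum x n k i)\<^sup>2)
        - 1 / (real n - real k) * (\<Sum>i=k+1..n. tail_sum x n k i)\<^sup>2))"

end

theory Submission
  imports Defs
begin

text \<open>
  Only the split point \<open>k = k*\<close> matters, because each statistic is a maximum of ratios over split
  points. At \<open>k*\<close> the tail observations are the errors themselves, up to the level \<open>\<mu>\<close>, and
  their centred sums have order \<open>n\<^bsup>1/2\<^esup>\<close>. The head observations, read backwards, are a random walk, so
  their centred sums are sums of a walk and have order \<open>n\<^bsup>3/2\<^esup>\<close>. The ratios therefore grow at
  least like \<open>n\<close>, provided that two degenerate events are excluded: a numerator that is too small
  and a denominator that vanishes.

  Both exclusions are properties of the limit path. Suppose that the rescaled partial sums of the
  errors are uniformly close to a continuous path \<open>y\<close> on \<open>[0,1]\<close>. If \<open>y 0 \<noteq> y \<theta>\<close>, the partial sums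
  stay on one side of their average on a whole window of indices of length proportional to \<open>n\<close>; the
  centred head sums are steep and monotone there, and this forces a spread of order \<open>n\<^bsup>3/2\<^esup>\<close>
  (\<open>head_spread_near_path\<close>). If the midpoint of \<open>[\<theta>,1]\<close> witnesses that \<open>y\<close> is not affine there,
  the centred tail sums cannot all vanish (\<open>tail_sum_nonzero_near_path\<close>). Together these give, for
  every \<open>C\<close>, a radius around \<open>y\<close> inside which all three statistics exceed \<open>C\<close> for large \<open>n\<close>
  (\<open>statistics_diverge_near_path\<close>). This part is deterministic.

  Almost every Wiener path satisfies both conditions, since \<open>W \<theta> - W 0\<close> and the second difference of
  \<open>W\<close> at the midpoint are normally distributed. The transfer from the limit to the probabilities is a
  form of the portmanteau theorem for events that depend on \<open>n\<close>
  (\<open>skorokhod_weak_conv_imp_prob_tendsto_1\<close>): if almost every limit path has a neighbourhood that lies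
  in the \<open>n\<close>-th event for all large \<open>n\<close>, the probabilities of the events tend to \<open>1\<close>.
\<close>

section \<open>Weak convergence in the Skorokhod space\<close>

text \<open>
  The element \<open>1\<close> caps the distance to \<open>B\<close>. It also gives the infimum a sensible value when \<open>B\<close> is
  empty, so that the test functions built from it below need no case distinction.
\<close>

lemma bounded_skorokhod_distance_Lipschitz:
  assumes x: "x \<in> cadlag01" and x': "x' \<in> cadlag01" and B: "B \<subseteq> cadlag01"
  shows "Inf (insert 1 (skorokhod_dist x ` B))
           \<le> Inf (insert 1 (skorokhod_dist x' ` B)) + skorokhod_dist x x'"
proof -
  interpret Metric_space cadlag01 skorokhod_dist by (rule Metric_space_skorokhod)
  have bdd: "bdd_below (insert 1 (skorokhod_dist x ` B))"
    by (rule bdd_belowI[of _ 0]) auto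
  have "Inf (insert 1 (skorokhod_dist x ` B)) - skorokhod_dist x x'
          \<le> Inf (insert 1 (skorokhod_dist x' ` B))"
  proof (rule cInf_greatest)
    fix v assume "v \<in> insert 1 (skorokhod_dist x' ` B)"
    then consider "v = 1" | b where "b \<in> B" "v = skorokhod_dist x' b" by auto
    then show "Inf (insert 1 (skorokhod_dist x ` B)) - skorokhod_dist x x' \<le> v"
    proof cases
      case 1
      have "Inf (insert 1 (skorokhod_dist x ` B)) \<le> 1" using bdd by (intro cInf_lower) auto
      with 1 nonneg[of x x'] show ?thesis by linarith
    next
      case 2
      have "Inf (insert 1 (skorokhod_dist x ` B)) \<le> skorokhod_dist x b"
        using bdd 2 by (intro cInf_lower) auto
      with 2 triangle[of x x' b] x x' B show ?thesis by auto
    qed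
  qed simp
  then show ?thesis by linarith
qed

lemma continuous_map_skorokhodI:
  assumes "\<And>x y. x \<in> cadlag01 \<Longrightarrow> y \<in> cadlag01 \<Longrightarrow> \<bar>f x - f y\<bar> \<le> L * skorokhod_dist x y"
    and L: "0 < L"
  shows "continuous_map skorokhod_topology euclideanreal f"
proof -
  have "continuous_map (Metric_space.mtopology cadlag01 skorokhod_dist)
          (Metric_space.mtopology UNIV dist) f"
    unfolding Metric_space.metric_continuous_map[OF Metric_space_skorokhod Met_TC.Metric_space_axioms]
  proof (intro conjI ballI allI impI)
    fix a and e :: real assume a: "a \<in> cadlag01" and e: "0 < e"
    have "dist (f a) (f x) < e" if "x \<in> cadlag01" "skorokhod_dist a x < e / L" for x
    proof -
      have "L * skorokhod_dist a x < e" using that(2) L by (simp add: field_simps)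
      with assms(1)[OF a that(1)] show ?thesis by (simp add: dist_real_def)
    qed
    with e L show "\<exists>d>0. \<forall>x. x \<in> cadlag01 \<and> skorokhod_dist a x < d \<longrightarrow> dist (f a) (f x) < e"
      by (intro exI[of _ "e / L"]) auto
  qed simp
  then show ?thesis by (simp add: skorokhod_topology_def)
qed

lemma space_skorokhod_borel: "space skorokhod_borel = cadlag01"
proof -
  interpret Metric_space cadlag01 skorokhod_dist by (rule Metric_space_skorokhod)
  have "U \<subseteq> cadlag01" if "openin skorokhod_topology U" for U
    using openin_subset[OF that] by (simp add: skorokhod_topology_def)
  then show ?thesis by (auto simp: skorokhod_borel_def space_measure_of_conv)
qed

lemma continuous_map_imp_skorokhod_borel_measurable:
  assumes f: "continuous_map skorokhod_topology euclideanreal f"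
  shows "f \<in> borel_measurable skorokhod_borel"
proof (rule borel_measurableI)
  interpret Metric_space cadlag01 skorokhod_dist by (rule Metric_space_skorokhod)
  fix S :: "real set" assume "open S"
  have sub: "{U. openin skorokhod_topology U} \<subseteq> Pow cadlag01"
    using openin_subset[of skorokhod_topology] by (auto simp: skorokhod_topology_def)
  have "openin skorokhod_topology {x \<in> topspace skorokhod_topology. f x \<in> S}"
    using openin_continuous_map_preimage[OF f, of S] \<open>open S\<close> by simp
  moreover have "{x \<in> topspace skorokhod_topology. f x \<in> S} = f -` S \<inter> space skorokhod_borel"
    by (auto simp: space_skorokhod_borel) (auto simp: skorokhod_topology_def)
  ultimately show "f -` S \<inter> space skorokhod_borel \<in> sets skorokhod_borel"
    using sub by (auto simp: skorokhod_borel_def)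
qed

text \<open>
  Let \<open>B m\<close> be the set of paths for which radius \<open>1 / (m + 1)\<close> and threshold \<open>m\<close> are good enough. By
  assumption almost every limit path lies in \<open>B m\<close> from some \<open>m\<close> on. The tent function \<open>f m\<close>, equal
  to \<open>1\<close> on \<open>B m\<close> and \<open>0\<close> at distance \<open>1 / (m + 1)\<close> from it, is continuous and bounded; for
  \<open>n \<ge> m\<close> it is dominated at \<open>Y n\<close> by the indicator of \<open>A n\<close>. So the probability of \<open>A n\<close> is
  eventually at least the expectation of \<open>f m\<close> at \<open>Z\<close>, up to an arbitrarily small error, and this
  expectation tends to \<open>1\<close> as \<open>m\<close> grows. Integrating \<open>f m\<close> instead of measuring \<open>B m\<close> avoids the
  question whether \<open>B m\<close> is a Borel set.
\<close>

lemma skorokhod_weak_conv_imp_prob_tendsto_1: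
  assumes M: "prob_space M" and N: "prob_space N"
    and conv: "skorokhod_weak_conv M Y N Z"
    and A: "\<forall>\<^sub>F n in sequentially. A n \<in> sets M"
    and near: "AE \<omega> in N. \<exists>r>0. \<forall>\<^sub>F n in sequentially. \<forall>\<omega>'\<in>space M.
                 skorokhod_dist (Z \<omega>) (Y n \<omega>') < r \<longrightarrow> \<omega>' \<in> A n"
  shows "(\<lambda>n. measure M (A n)) \<longlonglongrightarrow> 1"
proof -
  interpret S: Metric_space cadlag01 skorokhod_dist by (rule Metric_space_skorokhod)
  interpret M: prob_space M by fact
  interpret N: prob_space N by fact
  have Y[measurable]: "Y n \<in> M \<rightarrow>\<^sub>M skorokhod_borel" for n
    using conv by (simp add: skorokhod_weak_conv_def)
  have Z[measurable]: "Z \<in> N \<rightarrow>\<^sub>M skorokhod_borel"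
    using conv by (simp add: skorokhod_weak_conv_def)
  have Yc: "Y n \<omega> \<in> cadlag01" if "\<omega> \<in> space M" for n \<omega>
    using measurable_space[OF Y that] by (simp add: space_skorokhod_borel)
  have Zc: "Z \<omega> \<in> cadlag01" if "\<omega> \<in> space N" for \<omega>
    using measurable_space[OF Z that] by (simp add: space_skorokhod_borel)
  define B where "B m = {y \<in> cadlag01. \<forall>n\<ge>m. \<forall>\<omega>'\<in>space M.
     skorokhod_dist y (Y n \<omega>') < 1 / (real m + 1) \<longrightarrow> \<omega>' \<in> A n}" for m :: nat
  define D where "D m x = Inf (insert 1 (skorokhod_dist x ` B m))" for m x
  define f where "f m x = max 0 (1 - (real m + 1) * D m x)" for m x
  have Bc: "B m \<subseteq> cadlag01" for m by (auto simp: B_def)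
  have D0: "0 \<le> D m x" for m x
    unfolding D_def by (rule cInf_greatest) auto
  have f01: "0 \<le> f m x" "f m x \<le> 1" for m x
    using D0[of m x] by (auto simp: f_def)
  have cont: "continuous_map skorokhod_topology euclideanreal (f m)" for m
  proof (rule continuous_map_skorokhodI)
    fix x y assume xy: "x \<in> cadlag01" "y \<in> cadlag01"
    have "\<bar>D m x - D m y\<bar> \<le> skorokhod_dist x y"
      using bounded_skorokhod_distance_Lipschitz[OF xy Bc[of m]]
        bounded_skorokhod_distance_Lipschitz[OF xy(2,1) Bc[of m]] S.commute[of x y]
      unfolding D_def by linarith
    then have "\<bar>(real m + 1) * D m x - (real m + 1) * D m y\<bar> \<le> (real m + 1) * skorokhod_dist x y"
      by (simp add: abs_mult flip: right_diff_distrib)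
    then show "\<bar>f m x - f m y\<bar> \<le> (real m + 1) * skorokhod_dist x y"
      unfolding f_def by linarith
  qed simp
  have f_meas[measurable]: "f m \<in> borel_measurable skorokhod_borel" for m
    using cont by (rule continuous_map_imp_skorokhod_borel_measurable)
  have f_pos: "\<omega>' \<in> A n" if "m \<le> n" "\<omega>' \<in> space M" "0 < f m (Y n \<omega>')" for m n \<omega>'
  proof -
    have "D m (Y n \<omega>') < 1 / (real m + 1)"
      using that(3) by (simp add: f_def field_simps max_def split: if_splits)
    then obtain v where "v \<in> insert 1 (skorokhod_dist (Y n \<omega>') ` B m)" "v < 1 / (real m + 1)"
      unfolding D_def by (meson cInf_lessD insert_not_empty)
    moreover have "1 / (real m + 1) \<le> 1" by simp
    ultimately obtain b where "b \<in> B m" "skorokhod_dist (Y n \<omega>') b < 1 / (real m + 1)" by auto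
    with that(1,2) show ?thesis by (auto simp: B_def S.commute[of _ b])
  qed
  have bound: "(\<integral>\<omega>. f m (Y n \<omega>) \<partial>M) \<le> measure M (A n)" if "m \<le> n" "A n \<in> sets M" for m n
  proof -
    have "(\<integral>\<omega>. f m (Y n \<omega>) \<partial>M) \<le> (\<integral>\<omega>. indicator (A n) \<omega> \<partial>M)"
    proof (rule integral_mono)
      show "integrable M (\<lambda>\<omega>. f m (Y n \<omega>))"
        by (rule M.integrable_const_bound[of _ 1]) (auto simp: f01)
      show "f m (Y n \<omega>) \<le> indicator (A n) \<omega>" if "\<omega> \<in> space M" for \<omega>
        using f_pos[OF \<open>m \<le> n\<close> that] f01[of m "Y n \<omega>"] by (cases "\<omega> \<in> A n") force+
    qed (use that in \<open>auto intro: M.integrable_const_bound[of _ 1]\<close>)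
    also have "\<dots> = measure M (A n)" using that sets.sets_into_space[of "A n" M]
      by (simp add: Int_absorb2)
    finally show ?thesis .
  qed
  have lim1: "(\<lambda>m. \<integral>\<omega>. f m (Z \<omega>) \<partial>N) \<longlonglongrightarrow> (\<integral>\<omega>. 1 \<partial>N)"
  proof (rule integral_dominated_convergence[where w = "\<lambda>_. 1"])
    show "AE \<omega> in N. (\<lambda>m. f m (Z \<omega>)) \<longlonglongrightarrow> 1"
      using near AE_space
    proof eventually_elim
      case (elim \<omega>)
      then obtain r m0 where r: "r > 0" and m0: "\<And>n \<omega>'. n \<ge> m0 \<Longrightarrow> \<omega>' \<in> space M \<Longrightarrow>
          skorokhod_dist (Z \<omega>) (Y n \<omega>') < r \<Longrightarrow> \<omega>' \<in> A n"
        by (auto simp: eventually_sequentially)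
      have "\<forall>\<^sub>F m in sequentially. inverse (real (Suc m)) < r"
        using LIMSEQ_inverse_real_of_nat r by (rule order_tendstoD)
      then have "\<forall>\<^sub>F m in sequentially. f m (Z \<omega>) = 1"
        using eventually_ge_at_top[of m0]
      proof eventually_elim
        case (elim m)
        have "Z \<omega> \<in> B m"
          using elim m0 Zc[OF \<open>\<omega> \<in> space N\<close>]
          by (auto simp: B_def inverse_eq_divide add_ac)
        then have "D m (Z \<omega>) \<le> skorokhod_dist (Z \<omega>) (Z \<omega>)"
          unfolding D_def by (intro cInf_lower bdd_belowI[of _ 0]) auto
        also have "\<dots> = 0" using Zc[OF \<open>\<omega> \<in> space N\<close>] by simp
        finally show ?case using D0[of m "Z \<omega>"] by (simp add: f_def)
      qed
      then show ?case by (rule tendsto_eventually)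
    qed
  qed (use f01 in auto)
  show ?thesis
  proof (rule LIMSEQ_I)
    fix e :: real assume e: "0 < e"
    have "\<forall>\<^sub>F m in sequentially. 1 - e < (\<integral>\<omega>. f m (Z \<omega>) \<partial>N)"
      using lim1 e by (intro order_tendstoD(1)) (auto simp: N.prob_space)
    then obtain m where m: "1 - e < (\<integral>\<omega>. f m (Z \<omega>) \<partial>N)"
      by (auto simp: eventually_sequentially)
    have "bounded (f m ` cadlag01)"
      unfolding bounded_iff using f01 by (intro exI[of _ 1]) (auto simp: abs_le_iff intro: order_trans[of _ 0])
    then have "(\<lambda>n. \<integral>\<omega>. f m (Y n \<omega>) \<partial>M) \<longlonglongrightarrow> (\<integral>\<omega>. f m (Z \<omega>) \<partial>N)"
      using conv cont[of m] unfolding skorokhod_weak_conv_def by blast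
    then have "\<forall>\<^sub>F n in sequentially. 1 - e < (\<integral>\<omega>. f m (Y n \<omega>) \<partial>M)"
      using m by (rule order_tendstoD)
    then have "\<forall>\<^sub>F n in sequentially. norm (measure M (A n) - 1) < e"
      using A eventually_ge_at_top[of m]
    proof eventually_elim
      case (elim n)
      with bound[of m n] M.prob_le_1[of "A n"] show ?case by auto
    qed
    then show "\<exists>no. \<forall>n\<ge>no. norm (measure M (A n) - 1) < e"
      by (simp add: eventually_sequentially)
  qed
qed

text \<open>
  Small Skorokhod balls around a continuous path lie in uniform ones: the time change moves the argument
  by little, which changes a uniformly continuous function by little.
\<close>

lemma skorokhod_dist_continuous_imp_uniformly_close:
  assumes y: "continuous_on {0..1} y" and c: "y \<in> cadlag01" and e: "0 < e"
  shows "\<exists>r>0. \<forall>z\<in>cadlag01. skorokhod_dist y z < r \<longrightarrow> (\<forall>t\<in>{0..1}. \<bar>z t - y t\<bar> \<le> e)"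
proof -
  have "uniformly_continuous_on {0..1} y" using y by (intro compact_uniformly_continuous) auto
  then obtain d where d: "0 < d" and
    dy: "\<And>s t. s \<in> {0..1} \<Longrightarrow> t \<in> {0..1} \<Longrightarrow> dist s t < d \<Longrightarrow> dist (y s) (y t) < e / 2"
    using e unfolding uniformly_continuous_on_def by (metis half_gt_zero)
  show ?thesis
  proof (intro exI[of _ "min d (e/2)"] conjI ballI impI)
    fix z and t :: real assume z: "z \<in> cadlag01" and t: "t \<in> {0..1}" and "skorokhod_dist y z < min d (e/2)"
    then obtain f where f: "f < min d (e/2)" "skorokhod_close y z f"
      using skorokhod_dist_less_iff[OF c z] by blast
    then obtain l where l: "l \<in> time_changes"
      and cl: "\<forall>t\<in>{0..1}. \<bar>l t - t\<bar> \<le> f \<and> \<bar>z t - y (l t)\<bar> \<le> f"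
      using skorokhod_close_sym[OF f(2)] by (auto simp: skorokhod_close_def)
    have "dist (y (l t)) (y t) < e / 2"
      using bspec[OF cl t] t f by (intro dy time_changes_maps[OF l]) (auto simp: dist_real_def)
    moreover have "\<bar>z t - y (l t)\<bar> \<le> f" using cl t by blast
    ultimately show "\<bar>z t - y t\<bar> \<le> e" using f(1) unfolding dist_real_def by linarith
  qed (use d e in auto)
qed

section \<open>Nondegeneracy of Wiener paths\<close>

lemma (in prob_space) AE_normal_distributed_neq:
  assumes "distributed M lborel X (normal_density m s)"
  shows "AE \<omega> in M. X \<omega> \<noteq> c"
proof -
  have "AE x in lborel. 0 < ennreal (normal_density m s x) \<longrightarrow> x \<noteq> c"
    using AE_lborel_singleton[of c] by eventually_elim simp
  then show ?thesis using distributed_AE2[OF assms, of "\<lambda>x. x \<noteq> c"] by simp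
qed

lemma wiener_process_AE_increment_neq_0:
  assumes W: "wiener_process N W" and st: "0 \<le> s" "s < t"
  shows "AE \<omega> in N. W s \<omega> \<noteq> W t \<omega>"
proof -
  interpret prob_space N using W by (simp add: wiener_process_def)
  have "distributed N lborel (\<lambda>\<omega>. W t \<omega> - W s \<omega>) (normal_density 0 (sqrt (t - s)))"
    using W st by (simp add: wiener_process_def)
  from AE_normal_distributed_neq[OF this, of 0] show ?thesis by eventually_elim auto
qed

text \<open>
  The second difference is a difference of two independent centred normal increments, hence normal
  with positive variance, and has no atom at \<open>0\<close>.
\<close>

lemma wiener_process_AE_second_difference_neq_0:
  assumes W: "wiener_process N W" and st: "0 \<le> s" "s < t" "t < u"
  shows "AE \<omega> in N. W u \<omega> - W t \<omega> \<noteq> W t \<omega> - W s \<omega>"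
proof -
  interpret prob_space N using W by (simp add: wiener_process_def)
  define p where "p i = (if i = 0 then s else if i = Suc 0 then t else u)" for i :: nat
  have "0 \<le> p 0" "\<forall>i<2. p i \<le> p (Suc i)" using st by (auto simp: p_def less_Suc_eq numeral_2_eq_2)
  then have "indep_vars (\<lambda>_. borel) (\<lambda>i \<omega>. W (p (Suc i)) \<omega> - W (p i) \<omega>) {..<2}"
    using W unfolding wiener_process_def by blast
  moreover have "{..<2} = insert 1 {0::nat}" by auto
  ultimately have "indep_var borel (\<lambda>\<omega>. W u \<omega> - W t \<omega>) borel (\<lambda>\<omega>. W t \<omega> - W s \<omega>)"
    using indep_vars_sum[of "{0}" 1 "\<lambda>i \<omega>. W (p (Suc i)) \<omega> - W (p i) \<omega>"] by (simp add: p_def)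
  moreover have "distributed N lborel (\<lambda>\<omega>. W u \<omega> - W t \<omega>) (normal_density 0 (sqrt (u - t)))"
    "distributed N lborel (\<lambda>\<omega>. W t \<omega> - W s \<omega>) (normal_density 0 (sqrt (t - s)))"
    using W st by (simp_all add: wiener_process_def)
  ultimately have "distributed N lborel (\<lambda>\<omega>. (W u \<omega> - W t \<omega>) - (W t \<omega> - W s \<omega>))
      (normal_density (0 - 0) (sqrt ((sqrt (u - t))\<^sup>2 + (sqrt (t - s))\<^sup>2)))"
    using st by (intro diff_indep_normal) auto
  from AE_normal_distributed_neq[OF this, of 0] show ?thesis by eventually_elim auto
qed

section \<open>Sums of squares around a centre\<close>

lemma sum_squares_centered:
  fixes h :: "'i \<Rightarrow> real"
  assumes "c = real (card A)" and "0 < c"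
  shows "(\<Sum>i\<in>A. (h i)\<^sup>2) - 1 / c * (\<Sum>i\<in>A. h i)\<^sup>2 = (\<Sum>i\<in>A. (h i - (\<Sum>i\<in>A. h i) / c)\<^sup>2)"
proof -
  define m where "m = (\<Sum>i\<in>A. h i) / c"
  have S: "(\<Sum>i\<in>A. h i) = c * m" using assms by (simp add: m_def)
  have "(\<Sum>i\<in>A. (h i - m)\<^sup>2) = (\<Sum>i\<in>A. (h i)\<^sup>2 - 2 * m * h i + m\<^sup>2)"
    by (intro sum.cong refl) (simp add: power2_eq_square algebra_simps)
  also have "\<dots> = (\<Sum>i\<in>A. (h i)\<^sup>2) - 2 * m * (\<Sum>i\<in>A. h i) + c * m\<^sup>2"
    using assms(1) by (simp add: sum.distrib sum_subtractf sum_distrib_left)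
  also have "\<dots> = (\<Sum>i\<in>A. (h i)\<^sup>2) - 1 / c * (\<Sum>i\<in>A. h i)\<^sup>2"
    using assms(2) unfolding S by (simp add: power2_eq_square field_simps)
  finally show ?thesis by (simp add: m_def)
qed

text \<open>
  A function that rises by at least \<open>s\<close> at each step is spread out around any centre \<open>c\<close>: the values
  at \<open>i\<close> and \<open>i + w\<close> differ by at least \<open>s w\<close>, so their squared distances from \<open>c\<close> add up to at
  least \<open>(s w)\<^sup>2 / 2\<close>, and a window of length \<open>2 w\<close> contains \<open>w\<close> such disjoint pairs.
\<close>

lemma sum_squares_ge_of_increments:
  fixes h :: "nat \<Rightarrow> real"
  assumes s: "0 \<le> s" and inc: "\<And>i. a \<le> i \<Longrightarrow> i < a + 2 * w \<Longrightarrow> s \<le> h (Suc i) - h i"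
  shows "real w * (s * real w)\<^sup>2 / 2 \<le> (\<Sum>i\<in>{a<..a + 2 * w}. (h i - c)\<^sup>2)"
proof -
  have lin: "s * real m \<le> h (i + m) - h i" if "a \<le> i" "i + m \<le> a + 2 * w" for i m
    using that(2)
  proof (induction m)
    case (Suc m)
    with inc[of "i + m"] that(1) show ?case by (simp add: algebra_simps)
  qed simp
  have pair: "(s * real w)\<^sup>2 / 2 \<le> (h i - c)\<^sup>2 + (h (i + w) - c)\<^sup>2" if "i \<in> {a<..a + w}" for i
  proof -
    have "(s * real w)\<^sup>2 \<le> (h (i + w) - h i)\<^sup>2"
      using lin[of i w] that s by (intro power_mono) auto
    also have "\<dots> \<le> 2 * ((h i - c)\<^sup>2 + (h (i + w) - c)\<^sup>2)"
      using zero_le_power2[of "h i - c + (h (i + w) - c)"]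
      by (simp add: power2_eq_square algebra_simps)
    finally show ?thesis by simp
  qed
  have "real w * (s * real w)\<^sup>2 / 2 = (\<Sum>i\<in>{a<..a + w}. (s * real w)\<^sup>2 / 2)" by simp
  also have "\<dots> \<le> (\<Sum>i\<in>{a<..a + w}. (h i - c)\<^sup>2 + (h (i + w) - c)\<^sup>2)"
    by (intro sum_mono pair)
  also have "\<dots> = (\<Sum>i\<in>{a<..a + w}. (h i - c)\<^sup>2) + (\<Sum>i\<in>{a<..a + w}. (h (i + w) - c)\<^sup>2)"
    by (rule sum.distrib)
  also have "(\<Sum>i\<in>{a<..a + w}. (h (i + w) - c)\<^sup>2) = (\<Sum>i\<in>{a + w<..a + 2 * w}. (h i - c)\<^sup>2)"
    by (intro sum.reindex_bij_witness[of _ "\<lambda>i. i - w" "\<lambda>i. i + w"]) auto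
  also have "(\<Sum>i\<in>{a<..a + w}. (h i - c)\<^sup>2) + (\<Sum>i\<in>{a + w<..a + 2 * w}. (h i - c)\<^sup>2)
      = (\<Sum>i\<in>{a<..a + 2 * w}. (h i - c)\<^sup>2)"
    by (subst sum.union_disjoint[symmetric]) (auto intro!: sum.cong)
  finally show ?thesis .
qed

section \<open>Bounding the statistics from one split point\<close>

lemma finite_split_points: "0 \<le> \<delta> \<Longrightarrow> finite (split_points \<delta> n)"
proof -
  assume "0 \<le> \<delta>"
  then have "0 \<le> real n * \<delta>" by simp
  then have "split_points \<delta> n \<subseteq> {..n}" by (force simp: split_points_def)
  then show ?thesis by (rule finite_subset) simp
qed

lemma head_sum_self: "1 \<le> k \<Longrightarrow> head_sum x k k = 0"
  by (simp add: head_sum_def head_mean_def sum_subtractf)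

lemma tail_sum_Suc_self: "k < n \<Longrightarrow> tail_sum x n k (Suc k) = 0"
proof -
  assume "k < n"
  moreover have "{Suc k..n} = {k<..n}" by auto
  ultimately show ?thesis by (simp add: tail_sum_def tail_mean_def sum_subtractf of_nat_diff)
qed

text \<open>
  The numerator of \<open>V3\<close> controls the other two: it is at most \<open>k\<close> times the squared maximum of the
  absolute head sums, and this maximum is at most their range because the last head sum is \<open>0\<close>. In
  the same way the first tail sum over \<open>{k<..n}\<close> is \<open>0\<close>, so one nonzero tail sum makes all three
  denominators positive. Positivity has to be proved, since a vanishing denominator would turn the
  ratio into \<open>0\<close>.
\<close>

lemma statistics_lower_bounds:
  assumes \<delta>: "0 \<le> \<delta>" and k: "k \<in> split_points \<delta> n" "1 \<le> k" "k < n"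
    and Q: "0 \<le> Q"
      "Q \<le> (\<Sum>i=1..k. (head_sum x k i)\<^sup>2) - 1 / real k * (\<Sum>i=1..k. head_sum x k i)\<^sup>2"
    and B: "\<And>i. i \<in> {k..n} \<Longrightarrow> \<bar>tail_sum x n k i\<bar> \<le> B"
    and i: "i \<in> {k<..n}" "tail_sum x n k i \<noteq> 0"
  shows "sqrt (Q / n) / B \<le> V1 \<delta> n x"
    and "sqrt (Q / n) / (2 * B) \<le> V2 \<delta> n x"
    and "Q / (n * B\<^sup>2) \<le> V3 \<delta> n x"
proof -
  note fin = finite_split_points[OF \<delta>]
  define H where "H = (MAX i\<in>{1..k}. \<bar>head_sum x k i\<bar>)"
  have H: "\<bar>head_sum x k j\<bar> \<le> H" if "j \<in> {1..k}" for j
    unfolding H_def using that by (intro Max_ge) auto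
  have H0: "0 \<le> H" using H[of 1] k by force
  have "0 \<le> 1 / real k * (\<Sum>i=1..k. head_sum x k i)\<^sup>2" by simp
  with Q(2) have "Q \<le> (\<Sum>i=1..k. (head_sum x k i)\<^sup>2)" by linarith
  also have "\<dots> \<le> (\<Sum>i=1..k. H\<^sup>2)"
    using H H0 by (intro sum_mono) (simp add: abs_le_square_iff[symmetric])
  also have "\<dots> \<le> real n * H\<^sup>2" using k by (auto intro: mult_right_mono)
  finally have "Q / n \<le> H\<^sup>2" using k by (simp add: field_simps)
  then have QH: "sqrt (Q / n) \<le> H" using H0 real_le_lsqrt by simp
  have S: "0 \<le> sqrt (Q / n)" using Q by simp
  have B0: "0 < B" using B[of i] i by auto

  define T where "T = (MAX i\<in>{k..n}. \<bar>tail_sum x n k i\<bar>)"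
  have "\<bar>tail_sum x n k i\<bar> \<le> T" unfolding T_def using i by (intro Max_ge) auto
  then have T0: "0 < T" using i by auto
  have "T \<le> B" unfolding T_def using B k by (intro Max.boundedI) auto
  then have "sqrt (Q / n) / B \<le> H / T" using QH T0 S H0 by (intro frac_le) auto
  also have "\<dots> \<le> V1 \<delta> n x"
    unfolding V1_def H_def T_def using fin k by (intro Max_ge) auto
  finally show "sqrt (Q / n) / B \<le> V1 \<delta> n x" .

  define HR where "HR = (MAX i\<in>{1..k}. head_sum x k i) - (MIN i\<in>{1..k}. head_sum x k i)"
  have "\<bar>head_sum x k j\<bar> \<le> HR" if "j \<in> {1..k}" for j
  proof -
    have "head_sum x k l \<le> (MAX i\<in>{1..k}. head_sum x k i)"
      "(MIN i\<in>{1..k}. head_sum x k i) \<le> head_sum x k l" if "l \<in> {1..k}" for l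
      using that by (auto intro!: Max_ge Min_le)
    moreover have "k \<in> {1..k}" using k by simp
    ultimately show ?thesis
      using that head_sum_self[OF k(2), of x] unfolding HR_def by (smt (verit))
  qed
  then have "H \<le> HR" unfolding H_def using k by (intro Max.boundedI) auto
  define TR where "TR = (MAX i\<in>{k<..n}. tail_sum x n k i) - (MIN i\<in>{k<..n}. tail_sum x n k i)"
  have "0 < TR"
  proof -
    have "tail_sum x n k l \<le> (MAX i\<in>{k<..n}. tail_sum x n k i)"
      "(MIN i\<in>{k<..n}. tail_sum x n k i) \<le> tail_sum x n k l" if "l \<in> {k<..n}" for l
      using that by (auto intro!: Max_ge Min_le)
    moreover have "Suc k \<in> {k<..n}" using k by simp
    ultimately show ?thesis
      using i tail_sum_Suc_self[OF k(3), of x] unfolding TR_def by (smt (verit))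
  qed
  moreover have "TR \<le> 2 * B"
  proof -
    have "tail_sum x n k l \<le> B \<and> - B \<le> tail_sum x n k l" if "l \<in> {k<..n}" for l
      using B[of l] that by auto
    then have "(MAX i\<in>{k<..n}. tail_sum x n k i) \<le> B" "- B \<le> (MIN i\<in>{k<..n}. tail_sum x n k i)"
      using k by (auto intro!: Max.boundedI Min.boundedI)
    then show ?thesis unfolding TR_def by linarith
  qed
  ultimately have "sqrt (Q / n) / (2 * B) \<le> HR / TR"
    using QH S H0 \<open>H \<le> HR\<close> by (intro frac_le) auto
  also have "\<dots> \<le> V2 \<delta> n x"
    unfolding V2_def HR_def TR_def using fin k by (intro Max_ge) auto
  finally show "sqrt (Q / n) / (2 * B) \<le> V2 \<delta> n x" .

  define TV where "TV = (\<Sum>i=k+1..n. (tail_sum x n k i)\<^sup>2)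
        - 1 / (real n - real k) * (\<Sum>i=k+1..n. tail_sum x n k i)\<^sup>2"
  have "0 < TV"
  proof -
    define c where "c = (\<Sum>i=k+1..n. tail_sum x n k i) / (real n - real k)"
    have eq: "TV = (\<Sum>i=k+1..n. (tail_sum x n k i - c)\<^sup>2)"
      unfolding TV_def c_def using k by (intro sum_squares_centered) (auto simp: of_nat_diff)
    obtain l where "l \<in> {k+1..n}" "tail_sum x n k l \<noteq> c"
    proof (cases "c = 0")
      case True then show ?thesis using that[of i] i by auto
    next
      case False then show ?thesis using that[of "Suc k"] k tail_sum_Suc_self[of k n x] by auto
    qed
    then show ?thesis unfolding eq by (intro sum_pos2[of _ l]) auto
  qed
  moreover have "TV \<le> n * B\<^sup>2"
  proof -
    have "TV \<le> (\<Sum>i=k+1..n. (tail_sum x n k i)\<^sup>2)" unfolding TV_def using k by simp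
    also have "\<dots> \<le> (\<Sum>i=k+1..n. B\<^sup>2)"
      using B B0 by (intro sum_mono) (simp add: abs_le_square_iff[symmetric])
    also have "\<dots> \<le> n * B\<^sup>2" by (auto intro: mult_right_mono)
    finally show ?thesis .
  qed
  ultimately have "Q / (n * B\<^sup>2) \<le>
      ((\<Sum>i=1..k. (head_sum x k i)\<^sup>2) - 1 / real k * (\<Sum>i=1..k. head_sum x k i)\<^sup>2) / TV"
    using Q by (intro frac_le) auto
  also have "\<dots> \<le> V3 \<delta> n x"
    unfolding V3_def TV_def using fin k by (intro Max_ge) auto
  finally show "Q / (n * B\<^sup>2) \<le> V3 \<delta> n x" .
qed

section \<open>Centred sums under the change-point alternative\<close>

definition psum :: "(nat \<Rightarrow> real) \<Rightarrow> nat \<Rightarrow> real" where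
  "psum e i = (\<Sum>j=1..i. e j)"

text \<open>
  The pathwise form of the change-point alternative, for one realisation \<open>e\<close> of the errors.
\<close>

definition change_sample :: "real \<Rightarrow> (nat \<Rightarrow> real) \<Rightarrow> nat \<Rightarrow> nat \<Rightarrow> (nat \<Rightarrow> real) \<Rightarrow> bool" where
  "change_sample \<mu> e k n x \<longleftrightarrow>
     (\<forall>j\<in>{1..n}. x j = (if j \<le> k then \<mu> + (\<Sum>l=j..k. e l) else \<mu> + e j))"

lemma sum_eq_psum_diff: "a \<le> b \<Longrightarrow> (\<Sum>j\<in>{a<..b}. e j) = psum e b - psum e a"
proof -
  assume "a \<le> b"
  then have "{1..b} = {1..a} \<union> {a<..b}" by auto
  then have "psum e b = psum e a + (\<Sum>j\<in>{a<..b}. e j)"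
    unfolding psum_def by (simp only:) (rule sum.union_disjoint; auto)
  then show ?thesis by simp
qed

lemma change_sample_head:
  assumes "change_sample \<mu> e k n x" and "i < k" and "k \<le> n"
  shows "x (Suc i) = \<mu> + psum e k - psum e i"
proof -
  have "{Suc i..k} = {i<..k}" by auto
  with assms sum_eq_psum_diff[of i k e] show ?thesis by (auto simp: change_sample_def)
qed

text \<open>
  This is where the additional power of \<open>n\<close> comes from: a centred head sum moves at each step by the
  deviation of a partial sum of the errors from the average of these partial sums, a quantity of order
  \<open>n\<^bsup>1/2\<^esup>\<close>, and near a limit path that is not constant on the head it does so in the same
  direction for a number of steps proportional to \<open>n\<close>.
\<close>

lemma head_sum_increment:
  assumes x: "change_sample \<mu> e k n x" and i: "i < k" and k: "k \<le> n"
  shows "head_sum x k (Suc i) - head_sum x k i = (\<Sum>j<k. psum e j) / real k - psum e i"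
proof -
  have "(\<Sum>j=1..k. x j) = (\<Sum>j<k. x (Suc j))"
    by (rule sum.reindex_bij_witness[of _ Suc "\<lambda>j. j - 1"]) auto
  also have "\<dots> = (\<Sum>j<k. \<mu> + psum e k - psum e j)"
    using change_sample_head[OF x _ k] by (intro sum.cong) auto
  also have "\<dots> = real k * (\<mu> + psum e k) - (\<Sum>j<k. psum e j)"
    by (simp add: sum_subtractf)
  finally have "head_mean x k = \<mu> + psum e k - (\<Sum>j<k. psum e j) / real k"
    using i by (simp add: head_mean_def field_simps)
  then show ?thesis using change_sample_head[OF x i k] by (simp add: head_sum_def)
qed

lemma sum_change_sample_tail:
  assumes x: "change_sample \<mu> e k n x" and p: "k \<le> p" "p \<le> n"
  shows "(\<Sum>j\<in>{p<..n}. x j) = (real n - real p) * \<mu> + (psum e n - psum e p)"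
proof -
  have "(\<Sum>j\<in>{p<..n}. x j) = (\<Sum>j\<in>{p<..n}. \<mu> + e j)"
    using x p by (intro sum.cong) (auto simp: change_sample_def)
  also have "\<dots> = (real n - real p) * \<mu> + (\<Sum>j\<in>{p<..n}. e j)"
    using p by (simp add: sum.distrib of_nat_diff)
  finally show ?thesis using sum_eq_psum_diff[OF p(2), of e] by simp
qed

lemma tail_mean_change_sample:
  assumes x: "change_sample \<mu> e k n x" and k: "k < n"
  shows "tail_mean x n k = \<mu> + (psum e n - psum e k) / (real n - real k)"
  using sum_change_sample_tail[OF x, of k] k by (simp add: tail_mean_def field_simps)

lemma tail_sum_change_sample:
  assumes x: "change_sample \<mu> e k n x" and k: "k < n" and p: "k \<le> p" "p \<le> n"
  shows "tail_sum x n k (Suc p) =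
    psum e n - psum e p - (real n - real p) / (real n - real k) * (psum e n - psum e k)"
proof -
  have "{Suc p..n} = {p<..n}" by auto
  then have "tail_sum x n k (Suc p) = (\<Sum>j\<in>{p<..n}. x j) - (real n - real p) * tail_mean x n k"
    using p by (simp add: tail_sum_def sum_subtractf of_nat_diff)
  also have "\<dots> = psum e n - psum e p - (real n - real p) / (real n - real k) * (psum e n - psum e k)"
    using sum_change_sample_tail[OF x p] tail_mean_change_sample[OF x k]
    by (simp add: algebra_simps)
  finally show ?thesis .
qed

text \<open>
  The index \<open>i = k\<close>, which occurs in the denominator of \<open>V1\<close> only, is separate: the observation
  \<open>x k\<close> still belongs to the head but contains the single error \<open>e k\<close>, which is a difference of two
  partial sums.
\<close>

lemma abs_tail_sum_change_sample_le:
  assumes x: "change_sample \<mu> e k n x" and k: "1 \<le> k" "k < n"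
    and b: "\<And>i. i \<le> n \<Longrightarrow> \<bar>psum e i\<bar> \<le> b" and i: "i \<in> {k..n}"
  shows "\<bar>tail_sum x n k i\<bar> \<le> 4 * b"
proof (cases "i = k")
  case True
  have "{k..n} = insert k {Suc k..n}" using k by auto
  then have "tail_sum x n k k = x k - tail_mean x n k + tail_sum x n k (Suc k)"
    by (simp add: tail_sum_def)
  then have eq: "tail_sum x n k i = psum e k - psum e (k - 1) - (psum e n - psum e k) / (real n - real k)"
    using True k tail_sum_Suc_self[OF k(2), of x] tail_mean_change_sample[OF x k(2)]
      change_sample_head[OF x, of "k - 1"] by simp
  have "1 \<le> real n - real k" using k by linarith
  then have "\<bar>(psum e n - psum e k) / (real n - real k)\<bar> \<le> \<bar>psum e n - psum e k\<bar> / 1"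
    unfolding abs_divide by (intro frac_le) auto
  then have "\<bar>(psum e n - psum e k) / (real n - real k)\<bar> \<le> \<bar>psum e n - psum e k\<bar>" by simp
  moreover have "\<bar>psum e k\<bar> \<le> b" "\<bar>psum e (k - 1)\<bar> \<le> b" "\<bar>psum e n\<bar> \<le> b"
    using k by (auto intro!: b)
  ultimately show ?thesis unfolding eq by linarith
next
  case False
  define p where "p = i - 1"
  have p: "i = Suc p" "k \<le> p" "p \<le> n" using i False k by (auto simp: p_def)
  define q where "q = (real n - real p) / (real n - real k)"
  have "\<bar>q\<bar> \<le> 1" using p k unfolding q_def by (simp add: field_simps abs_le_iff)
  then have "\<bar>q * (psum e n - psum e k)\<bar> \<le> 1 * \<bar>psum e n - psum e k\<bar>"
    unfolding abs_mult by (intro mult_right_mono) auto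
  with b[of k] b[of p] b[of n] k p show ?thesis
    unfolding p(1) tail_sum_change_sample[OF x k(2) p(2,3)] q_def[symmetric] by auto
qed

section \<open>Samples whose errors follow a continuous path\<close>

definition follows_path :: "(real \<Rightarrow> real) \<Rightarrow> real \<Rightarrow> nat \<Rightarrow> (nat \<Rightarrow> real) \<Rightarrow> bool" where
  "follows_path y r n e \<longleftrightarrow> (\<forall>i\<le>n. \<bar>psum e i / sqrt (real n) - y (real i / real n)\<bar> \<le> r)"

lemma abs_divide_minus:
  fixes a b t :: real
  assumes "0 < b" shows "\<bar>a / b - t\<bar> = \<bar>a - b * t\<bar> / b"
proof -
  have "a / b - t = (a - b * t) / b" using assms by (simp add: field_simps)
  then show ?thesis using assms by simp
qed

text \<open>
  The average of the partial sums over \<open>{0..<k}\<close> cannot be close to both \<open>y 0\<close> and \<open>y \<theta>\<close>. So near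
  index \<open>0\<close> or near index \<open>k\<close> the partial sums lie on one side of their average, at a distance of
  order \<open>n\<^bsup>1/2\<^esup>\<close>, and the head sums are monotone with steps of that order along a window of length
  proportional to \<open>n\<close>.
\<close>

lemma head_spread_near_path:
  assumes y: "continuous_on {0..1} y" and \<theta>: "0 < \<theta>" "\<theta> < 1" and ne: "y 0 \<noteq> y \<theta>"
  shows "\<exists>r>0. \<exists>c>0. \<forall>\<^sub>F n in sequentially. \<forall>k e x. k = nat \<lfloor>real n * \<theta>\<rfloor> \<longrightarrow>
    follows_path y r n e \<longrightarrow> change_sample \<mu> e k n x \<longrightarrow>
    c * real n ^ 4
      \<le> (\<Sum>i=1..k. (head_sum x k i)\<^sup>2) - 1 / real k * (\<Sum>i=1..k. head_sum x k i)\<^sup>2"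
proof -
  define d where "d = \<bar>y \<theta> - y 0\<bar>"
  have d: "0 < d" using ne by (simp add: d_def)
  have "uniformly_continuous_on {0..1} y" using y by (intro compact_uniformly_continuous) auto
  then obtain \<eta>' where \<eta>': "0 < \<eta>'"
    "\<And>s t. s \<in> {0..1} \<Longrightarrow> t \<in> {0..1} \<Longrightarrow> dist s t < \<eta>' \<Longrightarrow> dist (y s) (y t) < d / 16"
    using d unfolding uniformly_continuous_on_def by (metis divide_pos_pos zero_less_numeral)
  \<comment> \<open>Taking \<open>\<eta> \<le> \<theta>\<close> lets a window of length \<open>n \<eta> / 2\<close> fit into \<open>{0..<k}\<close>.\<close>
  define \<eta> where "\<eta> = min \<eta>' \<theta>"
  have \<eta>: "0 < \<eta>" "\<eta> \<le> \<theta>" using \<eta>'(1) \<theta> by (auto simp: \<eta>_def)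
  have mod: "\<bar>y s - y t\<bar> < d / 16" if "s \<in> {0..1}" "t \<in> {0..1}" "\<bar>s - t\<bar> < \<eta>" for s t
    using \<eta>'(2)[OF that(1,2)] that(3) by (simp add: dist_real_def \<eta>_def)
  define c where "c = (\<eta> / 8) ^ 3 * d\<^sup>2 / 32"
  have "0 < c" using d \<eta> by (simp add: c_def)
  have main: "c * real n ^ 4 \<le> (\<Sum>i=1..k. (head_sum x k i)\<^sup>2) - 1 / real k * (\<Sum>i=1..k. head_sum x k i)\<^sup>2"
    if n: "8 / \<eta> \<le> real n" and close: "follows_path y (d / 16) n e"
      and x: "change_sample \<mu> e k n x" and k_def: "k = nat \<lfloor>real n * \<theta>\<rfloor>" for n e x k
  proof -
    have n8: "8 \<le> real n * \<eta>" using n \<eta> by (simp add: field_simps)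
    then have n0: "0 < real n" by (cases "n = 0") auto
    have n\<theta>: "real n * \<eta> \<le> real n * \<theta>" using \<eta> n0 by simp
    have k: "real n * \<theta> - 1 < real k" "real k \<le> real n * \<theta>"
      using n\<theta> n8 unfolding k_def by linarith+
    have "real n * \<theta> \<le> real n" using \<theta> by (simp add: mult_left_le)
    then have kn: "k \<le> n" using k(2) by linarith
    have k0: "0 < k" using k(1) n\<theta> n8 by linarith
    define w where "w = nat \<lfloor>real n * \<eta> / 4\<rfloor>"
    have w: "real n * \<eta> / 8 \<le> real w" "real w \<le> real n * \<eta> / 4"
      using n8 unfolding w_def by linarith+
    have wk: "2 * w \<le> k" using w k n8 n\<theta> by linarith
    \<comment> \<open>The head sums are increasing where the rescaled walk lies below its average \<open>A\<close>.\<close>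
    define A where "A = (\<Sum>j<k. psum e j) / real k / sqrt (real n)"
    define h where "h = head_sum x k"
    have inc: "h (Suc i) - h i = sqrt (real n) * (A - psum e i / sqrt (real n))" if "i < k" for i
      using head_sum_increment[OF x that kn] n0 by (simp add: h_def A_def right_diff_distrib)
    have pc: "\<bar>psum e i / sqrt (real n) - y (real i / real n)\<bar> \<le> d / 16" if "i < k" for i
      using close that kn by (simp add: follows_path_def)
    \<comment> \<open>The window starts at \<open>a\<close>, and the rescaled walk stays near \<open>v\<close> on it.\<close>
    obtain a v where a: "a + 2 * w \<le> k" and v: "d / 2 \<le> \<bar>A - v\<bar>"
      and av: "\<And>i. a \<le> i \<Longrightarrow> i < a + 2 * w \<Longrightarrow> \<bar>psum e i / sqrt (real n) - v\<bar> \<le> d / 8"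
    proof -
      have "d \<le> \<bar>A - y 0\<bar> + \<bar>A - y \<theta>\<bar>" unfolding d_def by linarith
      then have "d / 2 \<le> \<bar>A - y 0\<bar> \<or> d / 2 \<le> \<bar>A - y \<theta>\<bar>" by linarith
      then consider "d / 2 \<le> \<bar>A - y 0\<bar>" | "d / 2 \<le> \<bar>A - y \<theta>\<bar>" by blast
      then show thesis
      proof cases
        case 1
        show ?thesis
        proof (rule that[of 0 "y 0"])
          fix i assume i: "i < 0 + 2 * w"
          then have "real i < real n * \<eta>" using w(2) n8 by linarith
          then have "\<bar>real i / real n - 0\<bar> < \<eta>" using n0 by (simp add: field_simps)
          then have "\<bar>y (real i / real n) - y 0\<bar> < d / 16"
            using i wk kn n0 by (intro mod) auto
          with pc[of i] i wk show "\<bar>psum e i / sqrt (real n) - y 0\<bar> \<le> d / 8" by linarith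
        qed (use 1 wk in auto)
      next
        case 2
        show ?thesis
        proof (rule that[of "k - 2 * w" "y \<theta>"])
          fix i assume i: "k - 2 * w \<le> i" "i < k - 2 * w + 2 * w"
          then have "\<bar>real i - real n * \<theta>\<bar> < \<eta> * real n"
            using w(2) n8 k wk by (simp add: abs_less_iff mult.commute[of \<eta>])
          then have "\<bar>real i / real n - \<theta>\<bar> < \<eta>"
            using n0 by (simp add: abs_divide_minus pos_divide_less_eq)
          then have "\<bar>y (real i / real n) - y \<theta>\<bar> < d / 16"
            using i wk kn n0 \<theta> by (intro mod) auto
          with pc[of i] i wk show "\<bar>psum e i / sqrt (real n) - y \<theta>\<bar> \<le> d / 8" by linarith
        qed (use 2 wk in auto)
      qed
    qed
    define s where "s = sqrt (real n) * (d / 4)"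
    define m where "m = (\<Sum>i=1..k. h i) / real k"
    have s0: "0 \<le> s" using d by (simp add: s_def)
    have "real w * (s * real w)\<^sup>2 / 2 \<le> (\<Sum>i\<in>{a<..a + 2 * w}. (h i - m)\<^sup>2)"
    proof (cases "v \<le> A")
      case True
      show ?thesis
      proof (rule sum_squares_ge_of_increments[OF s0])
        fix i assume i: "a \<le> i" "i < a + 2 * w"
        then have "d / 4 \<le> A - psum e i / sqrt (real n)" using av[OF i] v True d by linarith
        then show "s \<le> h (Suc i) - h i"
          using i a n0 unfolding s_def by (subst inc) (auto intro: mult_left_mono)
      qed
    next
      case False
      have "real w * (s * real w)\<^sup>2 / 2 \<le> (\<Sum>i\<in>{a<..a + 2 * w}. (- h i - - m)\<^sup>2)"
      proof (rule sum_squares_ge_of_increments[OF s0])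
        fix i assume i: "a \<le> i" "i < a + 2 * w"
        then have "d / 4 \<le> psum e i / sqrt (real n) - A" using av[OF i] v False d by linarith
        then have "s \<le> sqrt (real n) * (psum e i / sqrt (real n) - A)"
          unfolding s_def by (intro mult_left_mono) auto
        also have "\<dots> = - (h (Suc i) - h i)" using i a by (subst inc) (auto simp: algebra_simps)
        finally show "s \<le> - h (Suc i) - - h i" by simp
      qed
      also have "\<dots> = (\<Sum>i\<in>{a<..a + 2 * w}. (h i - m)\<^sup>2)"
        by (intro sum.cong refl) (simp add: power2_commute)
      finally show ?thesis .
    qed
    also have "\<dots> \<le> (\<Sum>i=1..k. (h i - m)\<^sup>2)"
      using a by (intro sum_mono2) auto
    also have "\<dots> = (\<Sum>i=1..k. (h i)\<^sup>2) - 1 / real k * (\<Sum>i=1..k. h i)\<^sup>2"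
      unfolding m_def using k0 by (intro sum_squares_centered[symmetric]) auto
    finally have "real w * (s * real w)\<^sup>2 / 2 \<le> \<dots>" .
    moreover have "c * real n ^ 4 = (real n * \<eta> / 8) ^ 3 * (real n * d\<^sup>2 / 32)"
      by (simp add: c_def power_divide power_mult_distrib power3_eq_cube power4_eq_xxxx)
    moreover have "\<dots> \<le> real w ^ 3 * (real n * d\<^sup>2 / 32)"
      using w(1) \<eta> by (intro mult_right_mono power_mono) auto
    moreover have "\<dots> = real w * (s * real w)\<^sup>2 / 2"
      using n0 by (simp add: s_def power_mult_distrib power_divide power3_eq_cube power2_eq_square)
    ultimately show ?thesis unfolding h_def by linarith
  qed
  have "\<forall>\<^sub>F n in sequentially. 8 / \<eta> \<le> real n"
    using filterlim_real_sequentially by (simp add: filterlim_at_top)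
  then have "\<forall>\<^sub>F n in sequentially. \<forall>k e x. k = nat \<lfloor>real n * \<theta>\<rfloor> \<longrightarrow>
    follows_path y (d / 16) n e \<longrightarrow> change_sample \<mu> e k n x \<longrightarrow>
    c * real n ^ 4
      \<le> (\<Sum>i=1..k. (head_sum x k i)\<^sup>2) - 1 / real k * (\<Sum>i=1..k. head_sum x k i)\<^sup>2"
    by eventually_elim (use main in blast)
  with \<open>0 < c\<close> d show ?thesis by (intro exI[of _ "d / 16"] conjI exI[of _ c]) auto
qed

text \<open>
  If all tail sums vanish, the partial sums interpolate linearly between \<open>k\<close> and \<open>n\<close>. Then the
  limit path would take at the midpoint of \<open>[\<theta>,1]\<close> the mean of its values at the endpoints.
\<close>

lemma tail_sum_nonzero_near_path:
  assumes y: "continuous_on {0..1} y" and \<theta>: "0 < \<theta>" "\<theta> < 1"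
    and ne: "y 1 - y ((1 + \<theta>) / 2) \<noteq> y ((1 + \<theta>) / 2) - y \<theta>"
  shows "\<exists>r>0. \<forall>\<^sub>F n in sequentially. \<forall>k e x. k = nat \<lfloor>real n * \<theta>\<rfloor> \<longrightarrow>
    follows_path y r n e \<longrightarrow> change_sample \<mu> e k n x \<longrightarrow> (\<exists>i\<in>{k<..n}. tail_sum x n k i \<noteq> 0)"
proof -
  define m where "m = (1 + \<theta>) / 2"
  define g where "g = \<bar>y 1 - 2 * y m + y \<theta>\<bar>"
  have g: "0 < g" using ne by (simp add: g_def m_def)
  have "uniformly_continuous_on {0..1} y" using y by (intro compact_uniformly_continuous) auto
  then obtain \<eta> where \<eta>: "0 < \<eta>"
    and mod: "\<And>s t. s \<in> {0..1} \<Longrightarrow> t \<in> {0..1} \<Longrightarrow> dist s t < \<eta> \<Longrightarrow> dist (y s) (y t) < g / 16"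
    using g unfolding uniformly_continuous_on_def by (metis divide_pos_pos zero_less_numeral)
  define K where "K = \<bar>y 1\<bar> + \<bar>y \<theta>\<bar> + g"
  have K: "0 < K" using g unfolding K_def by linarith
  have main: "\<exists>i\<in>{k<..n}. tail_sum x n k i \<noteq> 0"
    if n: "2 / \<eta> \<le> real n" "4 * K / g / (1 - \<theta>) \<le> real n" "1 \<le> real n" 
      and close: "follows_path y (g / 16) n e"
      and x: "change_sample \<mu> e k n x" and k_def: "k = nat \<lfloor>real n * \<theta>\<rfloor>" for n e x k
  proof (rule ccontr)
    assume contra: "\<not> ?thesis"
    have n0: "0 < real n" using n(3) by linarith
    have "0 \<le> real n * \<theta>" using n0 \<theta> by simp
    then have k: "real n * \<theta> - 1 < real k" "real k \<le> real n * \<theta>"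
      unfolding k_def by linarith+
    have "real n * \<theta> < real n" using \<theta> n0 by simp
    then have kn: "k < n" using k(2) by linarith
    \<comment> \<open>For this \<open>p\<close> the interpolation weight at \<open>p\<close> differs from \<open>1 / 2\<close> by at most
      \<open>1 / (2 (n - k))\<close>, and rounding down keeps \<open>p < n\<close>.\<close>
    define p where "p = (n + k) div 2"
    have p: "k \<le> p" "p < n" using kn by (auto simp: p_def)
    have p2: "real n + real k - 1 \<le> 2 * real p" "2 * real p \<le> real n + real k"
      unfolding p_def by linarith+
    define z where "z i = psum e i / sqrt (real n)" for i
    have zc: "\<bar>z i - y (real i / real n)\<bar> \<le> g / 16" if "i \<le> n" for i
      using close that by (simp add: follows_path_def z_def)
    have near: "\<bar>z i - y t\<bar> \<le> g / 8" if "i \<le> n" "t \<in> {0..1}" "\<bar>real i - real n * t\<bar> \<le> 1" for i t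
    proof -
      have "\<bar>real i / real n - t\<bar> = \<bar>real i - real n * t\<bar> / real n"
        using n0 by (rule abs_divide_minus)
      also have "\<dots> \<le> 1 / real n" using that n0 by (intro divide_right_mono) auto
      also have "\<dots> < \<eta>" using n(1) n0 \<eta> by (simp add: field_simps)
      finally have "dist (y (real i / real n)) (y t) < g / 16"
        using that n0 by (intro mod) (auto simp: dist_real_def)
      with zc[OF that(1)] show ?thesis unfolding dist_real_def by linarith
    qed
    have zn: "\<bar>z n - y 1\<bar> \<le> g / 8" by (rule near) auto
    have zk: "\<bar>z k - y \<theta>\<bar> \<le> g / 8" using k kn \<theta> by (intro near) auto
    have zp: "\<bar>z p - y m\<bar> \<le> g / 8"
    proof (rule near)
      have "real n * m = (real n + real n * \<theta>) / 2" by (simp add: m_def algebra_simps)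
      moreover have "real p \<le> (real n + real n * \<theta>) / 2" "(real n + real n * \<theta>) / 2 \<le> real p + 1"
        using p2 k by simp_all
      ultimately show "\<bar>real p - real n * m\<bar> \<le> 1"
        by (simp add: abs_le_iff field_simps)
    qed (use p \<theta> in \<open>auto simp: m_def\<close>)
    have "tail_sum x n k (Suc p) = 0" using contra p by auto
    then have "(real n - real k) * (psum e n - psum e p) = (real n - real p) * (psum e n - psum e k)"
      using tail_sum_change_sample[OF x kn p(1)] p kn by (simp add: field_simps)
    then have "(real n - real k) * (z n - z p) = (real n - real p) * (z n - z k)"
      unfolding z_def by (simp add: diff_divide_distrib[symmetric])
    then have "(real n - real k) * (z n - 2 * z p + z k) = (real n + real k - 2 * real p) * (z n - z k)"
      by (simp add: algebra_simps)
    then have "(real n - real k) * \<bar>z n - 2 * z p + z k\<bar> = \<bar>real n + real k - 2 * real p\<bar> * \<bar>z n - z k\<bar>"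
      using kn by (metis abs_mult abs_of_pos diff_gt_0_iff_gt of_nat_less_iff)
    also have "\<dots> \<le> 1 * \<bar>z n - z k\<bar>" using p2 by (intro mult_right_mono) auto
    also have "1 * \<bar>z n - z k\<bar> \<le> \<bar>z n\<bar> + \<bar>z k\<bar>" by simp
    also have "\<dots> \<le> (\<bar>y 1\<bar> + g / 8) + (\<bar>y \<theta>\<bar> + g / 8)" using zn zk by (intro add_mono) linarith+
    also have "\<dots> \<le> K" using g by (simp add: K_def)
    finally have up: "(real n - real k) * \<bar>z n - 2 * z p + z k\<bar> \<le> K" .
    have lo: "g / 2 \<le> \<bar>z n - 2 * z p + z k\<bar>"
    proof -
      define D where "D = (z n - y 1) - 2 * (z p - y m) + (z k - y \<theta>)"
      have "\<bar>D\<bar> \<le> g / 8 + \<bar>2 * (z p - y m)\<bar> + g / 8"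
        using zn zk unfolding D_def by linarith
      also have "\<bar>2 * (z p - y m)\<bar> = 2 * \<bar>z p - y m\<bar>" by (simp only: abs_mult abs_numeral)
      also have "g / 8 + 2 * \<bar>z p - y m\<bar> + g / 8 \<le> g / 2" using zp by argo
      finally have "\<bar>D\<bar> \<le> g / 2" .
      moreover have "y 1 - 2 * y m + y \<theta> = (z n - 2 * z p + z k) - D"
        by (simp add: D_def)
      then have "g \<le> \<bar>z n - 2 * z p + z k\<bar> + \<bar>D\<bar>" unfolding g_def by linarith
      ultimately show ?thesis by linarith
    qed
    have "real n * (1 - \<theta>) \<le> real n - real k" using k by (simp add: algebra_simps)
    moreover have "4 * K / g \<le> real n * (1 - \<theta>)"
      by (rule iffD1[OF pos_divide_le_eq n(2)]) (use \<theta> in simp)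
    ultimately have "4 * K / g * (g / 2) \<le> (real n - real k) * \<bar>z n - 2 * z p + z k\<bar>"
      using lo g K kn by (intro mult_mono) auto
    with up K g show False by simp
  qed
  have large: "\<forall>\<^sub>F n in sequentially. C \<le> real n" for C
    using filterlim_real_sequentially by (simp add: filterlim_at_top)
  have "\<forall>\<^sub>F n in sequentially. \<forall>k e x. k = nat \<lfloor>real n * \<theta>\<rfloor> \<longrightarrow>
    follows_path y (g / 16) n e \<longrightarrow> change_sample \<mu> e k n x \<longrightarrow> (\<exists>i\<in>{k<..n}. tail_sum x n k i \<noteq> 0)"
    using large[of "2 / \<eta>"] large[of "4 * K / g / (1 - \<theta>)"] large[of 1]
    by eventually_elim (use main in blast)
  with g show ?thesis by (intro exI[of _ "g / 16"]) auto
qed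

text \<open>
  Near \<open>y\<close> the partial sums are bounded by a multiple of \<open>n\<^bsup>1/2\<^esup>\<close>, hence so are the tail sums, while
  the numerator of \<open>V3\<close> is of order \<open>n\<^sup>4\<close>. This makes \<open>V1\<close> and \<open>V2\<close> at least of order \<open>n\<close>, and \<open>V3\<close>
  at least of order \<open>n\<^sup>2\<close>.
\<close>

lemma statistics_diverge_near_path:
  assumes y: "continuous_on {0..1} y" and \<delta>: "0 < \<delta>" "\<delta> < \<theta>" "\<theta> < 1 - \<delta>"
    and ne: "y 0 \<noteq> y \<theta>" "y 1 - y ((1 + \<theta>) / 2) \<noteq> y ((1 + \<theta>) / 2) - y \<theta>"
  shows "\<exists>r>0. \<forall>\<^sub>F n in sequentially. \<forall>e x. follows_path y r n e \<longrightarrow>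
    change_sample \<mu> e (nat \<lfloor>real n * \<theta>\<rfloor>) n x \<longrightarrow> C < V1 \<delta> n x \<and> C < V2 \<delta> n x \<and> C < V3 \<delta> n x"
proof -
  have \<theta>: "0 < \<theta>" "\<theta> < 1" using \<delta> by auto
  obtain r1 c where r1: "0 < r1" and c: "0 < c" and
    ev1: "\<forall>\<^sub>F n in sequentially. \<forall>k e x. k = nat \<lfloor>real n * \<theta>\<rfloor> \<longrightarrow>
      follows_path y r1 n e \<longrightarrow> change_sample \<mu> e k n x \<longrightarrow>
      c * real n ^ 4
        \<le> (\<Sum>i=1..k. (head_sum x k i)\<^sup>2) - 1 / real k * (\<Sum>i=1..k. head_sum x k i)\<^sup>2"
    using head_spread_near_path[OF y \<theta> ne(1)] by blast
  obtain r2 where r2: "0 < r2" and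
    ev2: "\<forall>\<^sub>F n in sequentially. \<forall>k e x. k = nat \<lfloor>real n * \<theta>\<rfloor> \<longrightarrow>
      follows_path y r2 n e \<longrightarrow> change_sample \<mu> e k n x \<longrightarrow> (\<exists>i\<in>{k<..n}. tail_sum x n k i \<noteq> 0)"
    using tail_sum_nonzero_near_path[OF y \<theta> ne(2)] by blast
  \<comment> \<open>The bound \<open>1\<close> keeps the rescaled walk within \<open>b + 1\<close>, where \<open>b\<close> bounds \<open>y\<close>.\<close>
  define r where "r = min 1 (min r1 r2)"
  have mono: "follows_path y s n e" if "follows_path y r n e" "r \<le> s" for s n e
    using that by (force simp: follows_path_def)
  have "bounded (y ` {0..1})"
    using y by (intro compact_imp_bounded compact_continuous_image) auto
  then obtain b where "\<forall>t\<in>{0..1}. \<bar>y t\<bar> \<le> b" by (auto simp: bounded_iff)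
  then have b: "\<bar>y t\<bar> \<le> b" if "t \<in> {0..1}" for t using that by blast
  define K where "K = b + 1"
  have K: "0 < K" using b[of 0] by (auto simp: K_def)
  have large: "\<forall>\<^sub>F n in sequentially. a < real n" for a
    using filterlim_real_sequentially by (simp add: filterlim_at_top_dense)
  have "\<forall>\<^sub>F n in sequentially. \<forall>e x. follows_path y r n e \<longrightarrow>
    change_sample \<mu> e (nat \<lfloor>real n * \<theta>\<rfloor>) n x \<longrightarrow> C < V1 \<delta> n x \<and> C < V2 \<delta> n x \<and> C < V3 \<delta> n x"
    using ev1 ev2 large[of 1] large[of "1 / (\<theta> - \<delta>)"] large[of "8 * K * \<bar>C\<bar> / sqrt c"]
      large[of "16 * K\<^sup>2 * \<bar>C\<bar> / c"]
  proof eventually_elim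
    case (elim n)
    define k where "k = nat \<lfloor>real n * \<theta>\<rfloor>"
    show ?case
    proof (intro allI impI, fold k_def)
      fix e x assume close: "follows_path y r n e" and x: "change_sample \<mu> e k n x"
      have close12: "follows_path y r1 n e" "follows_path y r2 n e"
        by (rule mono[OF close]; simp add: r_def min_le_iff_disj)+
      have n1: "1 < real n" by fact
      have "1 < real n * (\<theta> - \<delta>)" using elim(4) \<delta> by (simp add: field_simps)
      then have n\<theta>: "real n * \<delta> + 1 < real n * \<theta>" by (simp add: algebra_simps)
      have n\<delta>: "0 < real n * \<delta>" using n1 \<delta> by simp
      have k: "real n * \<theta> - 1 < real k" "real k \<le> real n * \<theta>"
        using n\<theta> n\<delta> unfolding k_def by linarith+
      have "real n * \<theta> \<le> real n * (1 - \<delta>)" using \<delta> n1 by (intro mult_left_mono) auto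
      then have "k \<in> split_points \<delta> n"
        using k n\<theta> by (auto simp: split_points_def algebra_simps)
      moreover have k1: "1 \<le> k" using k(1) n\<theta> n\<delta> by linarith
      moreover have "real n * \<theta> < real n" using \<theta> n1 by simp
      with k(2) have kn: "k < n" by linarith
      moreover define Q where "Q = c * real n ^ 4"
      have "0 \<le> Q" using c by (simp add: Q_def)
      moreover have "Q \<le> (\<Sum>i=1..k. (head_sum x k i)\<^sup>2) - 1 / real k * (\<Sum>i=1..k. head_sum x k i)\<^sup>2"
        using elim(1) close12(1) x unfolding Q_def k_def by blast
      moreover define B where "B = 4 * (K * sqrt (real n))"
      have "\<bar>tail_sum x n k i\<bar> \<le> B" if "i \<in> {k..n}" for i
        unfolding B_def
      proof (rule abs_tail_sum_change_sample_le[OF x k1 kn _ that])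
        fix i assume i: "i \<le> n"
        have "\<bar>psum e i / sqrt (real n) - y (real i / real n)\<bar> \<le> r"
          using close i by (simp add: follows_path_def)
        moreover have "\<bar>y (real i / real n)\<bar> \<le> b" using i n1 by (intro b) auto
        moreover have "r \<le> 1" by (simp add: r_def)
        ultimately have "\<bar>psum e i / sqrt (real n)\<bar> \<le> K" unfolding K_def by linarith
        then show "\<bar>psum e i\<bar> \<le> K * sqrt (real n)" using n1 by (simp add: field_simps)
      qed
      moreover obtain i where "i \<in> {k<..n}" "tail_sum x n k i \<noteq> 0"
        using elim(2) close12(2) x unfolding k_def by blast
      ultimately have V: "sqrt (Q / n) / B \<le> V1 \<delta> n x" "sqrt (Q / n) / (2 * B) \<le> V2 \<delta> n x"
        "Q / (n * B\<^sup>2) \<le> V3 \<delta> n x"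
        using statistics_lower_bounds[of \<delta> k n Q x B i] \<delta> by auto
      have "Q / n = c * (real n)\<^sup>2 * real n"
        using n1 by (simp add: Q_def power4_eq_xxxx power2_eq_square)
      then have "sqrt (Q / n) = sqrt c * real n * sqrt (real n)"
        by (simp add: real_sqrt_mult)
      then have eq: "sqrt (Q / n) / (2 * B) = sqrt c * real n / (8 * K)"
        using n1 K by (simp add: B_def)
      have "8 * K * \<bar>C\<bar> < real n * sqrt c" using elim(5) c by (simp add: field_simps)
      then have C12: "\<bar>C\<bar> < sqrt (Q / n) / (2 * B)" unfolding eq using K by (simp add: field_simps)
      have "sqrt (Q / n) / (2 * B) \<le> sqrt (Q / n) / B"
        using K n1 \<open>0 \<le> Q\<close> unfolding B_def by (intro divide_left_mono) auto
      with C12 V have "C < V1 \<delta> n x" "C < V2 \<delta> n x" by linarith+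
      moreover have "C < V3 \<delta> n x"
      proof -
        have "16 * K\<^sup>2 * \<bar>C\<bar> < real n * c" using elim(6) c by (simp add: field_simps)
        also have "\<dots> \<le> real n * c * real n" using n1 c by simp
        finally have "\<bar>C\<bar> < c * (real n)\<^sup>2 / (16 * K\<^sup>2)"
          using K by (simp add: field_simps power2_eq_square)
        also have "\<dots> = Q / (n * B\<^sup>2)"
        proof -
          have "B\<^sup>2 = 16 * K\<^sup>2 * real n" by (simp add: B_def power_mult_distrib)
          then show ?thesis using n1 by (simp add: Q_def power4_eq_xxxx power2_eq_square)
        qed
        finally show ?thesis using V(3) by linarith
      qed
      ultimately show "C < V1 \<delta> n x \<and> C < V2 \<delta> n x \<and> C < V3 \<delta> n x" by simp
    qed
  qed
  with r1 r2 show ?thesis by (intro exI[of _ r]) (auto simp: r_def)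
qed

text \<open>
  At the grid point \<open>i / n\<close> the step path equals the rescaled partial sum exactly, so closeness of
  the step path on \<open>[0,1]\<close> passes to the partial sums without a discretisation error.
\<close>

lemma follows_path_scaled_partial_sums:
  assumes n: "0 < n"
    and close: "\<And>t. t \<in> {0..1} \<Longrightarrow> \<bar>scaled_partial_sums \<epsilon> n \<omega> t - y t\<bar> \<le> r"
  shows "follows_path y r n (\<lambda>j. \<epsilon> j \<omega>)"
  unfolding follows_path_def
proof (intro allI impI)
  fix i assume i: "i \<le> n"
  then have t: "real i / real n \<in> {0..1}" using n by simp
  have "{j. 1 \<le> j \<and> real j \<le> real n * (real i / real n)} = {1..i}" using n by auto
  then have "scaled_partial_sums \<epsilon> n \<omega> (real i / real n) = psum (\<lambda>j. \<epsilon> j \<omega>) i / sqrt (real n)"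
    using t unfolding scaled_partial_sums_def psum_def by simp
  with close[OF t] show "\<bar>psum (\<lambda>j. \<epsilon> j \<omega>) i / sqrt (real n) - y (real i / real n)\<bar> \<le> r" by simp
qed

section \<open>Measurability of the statistics\<close>

text \<open>
  The hypotheses \<open>0 < \<delta>\<close> and \<open>1 \<le> n\<close> exclude the split point \<open>0\<close>, at which \<open>V1\<close> would involve the
  observation with index \<open>0\<close>.
\<close>

lemma borel_measurable_change_point_statistics:
  assumes \<delta>: "0 < \<delta>" and n: "1 \<le> n" and f: "\<And>j. j \<in> {1..n} \<Longrightarrow> f j \<in> borel_measurable M"
  shows "(\<lambda>\<omega>. V1 \<delta> n (\<lambda>j. f j \<omega>)) \<in> borel_measurable M"
    and "(\<lambda>\<omega>. V2 \<delta> n (\<lambda>j. f j \<omega>)) \<in> borel_measurable M"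
    and "(\<lambda>\<omega>. V3 \<delta> n (\<lambda>j. f j \<omega>)) \<in> borel_measurable M"
proof -
  note fin = finite_split_points[OF less_imp_le[OF \<delta>]]
  have k: "1 \<le> k" "k \<le> n" if "k \<in> split_points \<delta> n" for k
  proof -
    have "0 < real n * \<delta>" using n \<delta> by simp
    with that show "1 \<le> k" "k \<le> n" by (auto simp: split_points_def)
  qed
  have head: "(\<lambda>\<omega>. head_sum (\<lambda>j. f j \<omega>) k i) \<in> borel_measurable M" if "k \<le> n" "i \<le> n" for k i
    unfolding head_sum_def head_mean_def using that
    by (intro borel_measurable_sum borel_measurable_diff borel_measurable_divide f borel_measurable_const) auto
  have tail: "(\<lambda>\<omega>. tail_sum (\<lambda>j. f j \<omega>) n k i) \<in> borel_measurable M" if "1 \<le> i" for k i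
    unfolding tail_sum_def tail_mean_def using that
    by (intro borel_measurable_sum borel_measurable_diff borel_measurable_divide f borel_measurable_const) auto
  show "(\<lambda>\<omega>. V1 \<delta> n (\<lambda>j. f j \<omega>)) \<in> borel_measurable M"
    unfolding V1_def using k
    by (intro borel_measurable_Max fin borel_measurable_divide borel_measurable_abs head tail) force+
  show "(\<lambda>\<omega>. V2 \<delta> n (\<lambda>j. f j \<omega>)) \<in> borel_measurable M"
    unfolding V2_def using k
    by (intro borel_measurable_Max borel_measurable_Min fin borel_measurable_divide
        borel_measurable_diff head tail) force+
  show "(\<lambda>\<omega>. V3 \<delta> n (\<lambda>j. f j \<omega>)) \<in> borel_measurable M"
    unfolding V3_def using k
    by (intro borel_measurable_Max fin borel_measurable_divide borel_measurable_diff
        borel_measurable_sum borel_measurable_times borel_measurable_power borel_measurable_const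
        head tail) force+
qed

section \<open>Divergence of the statistics\<close>

lemma change_alternative_imp_change_sample:
  assumes "change_alternative M \<epsilon> \<mu> n k X" and "\<omega> \<in> space M"
  shows "change_sample \<mu> (\<lambda>j. \<epsilon> j \<omega>) k n (\<lambda>j. X j \<omega>)"
  using assms by (auto simp: change_alternative_def change_sample_def)

lemma change_alternative_borel_measurable:
  assumes X: "change_alternative M \<epsilon> \<mu> n k X"
    and \<epsilon>: "\<And>i. 1 \<le> i \<Longrightarrow> \<epsilon> i \<in> borel_measurable M" and j: "j \<in> {1..n}"
  shows "X j \<in> borel_measurable M"
proof -
  have "(\<lambda>\<omega>. if j \<le> k then \<mu> + (\<Sum>l=j..k. \<epsilon> l \<omega>) else \<mu> + \<epsilon> j \<omega>) \<in> borel_measurable M"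
    using \<epsilon> j by (cases "j \<le> k") (auto intro!: borel_measurable_add borel_measurable_sum)
  moreover have "X j \<omega> = (if j \<le> k then \<mu> + (\<Sum>l=j..k. \<epsilon> l \<omega>) else \<mu> + \<epsilon> j \<omega>)"
    if "\<omega> \<in> space M" for \<omega>
    using X that j by (simp add: change_alternative_def)
  ultimately show ?thesis by (simp cong: measurable_cong)
qed

theorem theorem1p4:
  fixes M :: "'a measure" and N :: "'b measure"
    and \<epsilon> :: "nat \<Rightarrow> 'a \<Rightarrow> real" and W :: "real \<Rightarrow> 'b \<Rightarrow> real"
    and X :: "nat \<Rightarrow> nat \<Rightarrow> 'a \<Rightarrow> real" and kstar :: "nat \<Rightarrow> nat"
    and \<delta> \<sigma> \<mu> \<theta> :: real
  assumes "0 < \<delta>" and "\<delta> < 1 / 2"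
    and "prob_space M"
    and "\<And>i. 1 \<le> i \<Longrightarrow> integrable M (\<epsilon> i)"
    and "\<And>i. 1 \<le> i \<Longrightarrow> (\<integral>\<omega>. \<epsilon> i \<omega> \<partial>M) = 0"
    and "0 < \<sigma>"
    and "wiener_process N W"
    and "skorokhod_weak_conv M (scaled_partial_sums \<epsilon>) N (\<lambda>\<omega>. \<lambda>t\<in>{0..1}. \<sigma> * W t \<omega>)"
    and "0 < \<theta>" and "\<theta> < 1"
    and "\<forall>\<^sub>F n in sequentially. kstar n = nat \<lfloor>real n * \<theta>\<rfloor>"
    and "\<forall>\<^sub>F n in sequentially. change_alternative M \<epsilon> \<mu> n (kstar n) (X n)"
    and "\<delta> < \<theta>" and "\<theta> < 1 - \<delta>"
  shows "diverges_in_probability M (\<lambda>n \<omega>. V1 \<delta> n (\<lambda>k. X n k \<omega>)) \<and>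
         diverges_in_probability M (\<lambda>n \<omega>. V2 \<delta> n (\<lambda>k. X n k \<omega>)) \<and>
         diverges_in_probability M (\<lambda>n \<omega>. V3 \<delta> n (\<lambda>k. X n k \<omega>))"
proof -
  note \<delta> = assms(1) and M = assms(3) and integrable_\<epsilon> = assms(4) and \<sigma> = assms(6)
    and W = assms(7) and conv = assms(8) and \<theta> = assms(9,10) and kstar = assms(11)
    and alternative = assms(12) and \<delta>\<theta> = assms(13,14)
  have N: "prob_space N" using W by (simp add: wiener_process_def)
  define Z where "Z \<omega> = (\<lambda>t\<in>{0..1}. \<sigma> * W t \<omega>)" for \<omega>
  have conv_Z: "skorokhod_weak_conv M (scaled_partial_sums \<epsilon>) N Z"
    using conv by (simp add: Z_def[abs_def])
  have Z_cadlag: "Z \<omega> \<in> cadlag01" if "\<omega> \<in> space N" for \<omega>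
    using conv_Z measurable_space[OF _ that, of Z skorokhod_borel]
    by (auto simp: skorokhod_weak_conv_def space_skorokhod_borel)
  have sums_cadlag: "scaled_partial_sums \<epsilon> n \<omega> \<in> cadlag01" if "\<omega> \<in> space M" for n \<omega>
    using conv_Z measurable_space[OF _ that, of "scaled_partial_sums \<epsilon> n" skorokhod_borel]
    by (auto simp: skorokhod_weak_conv_def space_skorokhod_borel)
  have Z_cont: "continuous_on {0..1} (Z \<omega>)" if "\<omega> \<in> space N" for \<omega>
  proof -
    have "continuous_on {0..} (\<lambda>t. W t \<omega>)" using W that by (simp add: wiener_process_def)
    then have "continuous_on {0..1} (\<lambda>t. \<sigma> * W t \<omega>)"
      by (intro continuous_intros continuous_on_subset[where t = "{0..1}"]) auto
    then show ?thesis by (rule continuous_on_eq) (simp add: Z_def)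
  qed
  have bend: "AE \<omega> in N. W 1 \<omega> - W ((1 + \<theta>) / 2) \<omega> \<noteq> W ((1 + \<theta>) / 2) \<omega> - W \<theta> \<omega>"
    using \<theta> by (intro wiener_process_AE_second_difference_neq_0[OF W]) auto
  have near: "AE \<omega> in N. \<exists>r>0. \<forall>\<^sub>F n in sequentially. \<forall>\<omega>'\<in>space M.
      skorokhod_dist (Z \<omega>) (scaled_partial_sums \<epsilon> n \<omega>') < r \<longrightarrow>
      C < V1 \<delta> n (\<lambda>k. X n k \<omega>') \<and> C < V2 \<delta> n (\<lambda>k. X n k \<omega>') \<and> C < V3 \<delta> n (\<lambda>k. X n k \<omega>')" for C
    using wiener_process_AE_increment_neq_0[OF W order_refl \<theta>(1)] bend AE_space
  proof eventually_elim
    case (elim \<omega>)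
    have "Z \<omega> 0 \<noteq> Z \<omega> \<theta>" using elim(1) \<sigma> \<theta> by (simp add: Z_def)
    moreover have "W 1 \<omega> - W ((1 + \<theta>) / 2) \<omega> \<noteq> W ((1 + \<theta>) / 2) \<omega> - W \<theta> \<omega>"
      using elim(2) \<theta> by simp
    then have "\<sigma> * (W 1 \<omega> - W ((1 + \<theta>) / 2) \<omega>) \<noteq> \<sigma> * (W ((1 + \<theta>) / 2) \<omega> - W \<theta> \<omega>)"
      using \<sigma> by simp
    then have "Z \<omega> 1 - Z \<omega> ((1 + \<theta>) / 2) \<noteq> Z \<omega> ((1 + \<theta>) / 2) - Z \<omega> \<theta>"
      using \<theta> by (simp add: Z_def right_diff_distrib)
    ultimately obtain r where r: "0 < r" and path: "\<forall>\<^sub>F n in sequentially. \<forall>e x.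
        follows_path (Z \<omega>) r n e \<longrightarrow> change_sample \<mu> e (nat \<lfloor>real n * \<theta>\<rfloor>) n x \<longrightarrow>
        C < V1 \<delta> n x \<and> C < V2 \<delta> n x \<and> C < V3 \<delta> n x"
      using statistics_diverge_near_path[OF Z_cont[OF elim(3)] \<delta> \<delta>\<theta>] by blast
    obtain q where q: "0 < q" and close: "\<forall>z\<in>cadlag01. skorokhod_dist (Z \<omega>) z < q \<longrightarrow>
        (\<forall>t\<in>{0..1}. \<bar>z t - Z \<omega> t\<bar> \<le> r)"
      using skorokhod_dist_continuous_imp_uniformly_close[OF Z_cont[OF elim(3)] Z_cadlag[OF elim(3)] r]
      by blast
    have "\<forall>\<^sub>F n in sequentially. \<forall>\<omega>'\<in>space M.
      skorokhod_dist (Z \<omega>) (scaled_partial_sums \<epsilon> n \<omega>') < q \<longrightarrow>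
      C < V1 \<delta> n (\<lambda>k. X n k \<omega>') \<and> C < V2 \<delta> n (\<lambda>k. X n k \<omega>') \<and> C < V3 \<delta> n (\<lambda>k. X n k \<omega>')"
      using path kstar alternative eventually_gt_at_top[of 0]
    proof eventually_elim
      case (elim n)
      show ?case
      proof (intro ballI impI)
        fix \<omega>' assume \<omega>': "\<omega>' \<in> space M"
          and "skorokhod_dist (Z \<omega>) (scaled_partial_sums \<epsilon> n \<omega>') < q"
        then have "follows_path (Z \<omega>) r n (\<lambda>j. \<epsilon> j \<omega>')"
          using close sums_cadlag[OF \<omega>'] elim(4) by (intro follows_path_scaled_partial_sums) auto
        moreover have "change_sample \<mu> (\<lambda>j. \<epsilon> j \<omega>') (nat \<lfloor>real n * \<theta>\<rfloor>) n (\<lambda>k. X n k \<omega>')"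
          using change_alternative_imp_change_sample[OF elim(3) \<omega>'] elim(2) by simp
        ultimately show "C < V1 \<delta> n (\<lambda>k. X n k \<omega>') \<and> C < V2 \<delta> n (\<lambda>k. X n k \<omega>') \<and>
            C < V3 \<delta> n (\<lambda>k. X n k \<omega>')"
          using elim(1) by blast
      qed
    qed
    with q show ?case by blast
  qed
  have meas: "\<forall>\<^sub>F n in sequentially.
      (\<lambda>\<omega>. V1 \<delta> n (\<lambda>k. X n k \<omega>)) \<in> borel_measurable M \<and>
      (\<lambda>\<omega>. V2 \<delta> n (\<lambda>k. X n k \<omega>)) \<in> borel_measurable M \<and>
      (\<lambda>\<omega>. V3 \<delta> n (\<lambda>k. X n k \<omega>)) \<in> borel_measurable M"
    using alternative eventually_ge_at_top[of 1]
  proof eventually_elim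
    case (elim n)
    have "X n j \<in> borel_measurable M" if "j \<in> {1..n}" for j
      using integrable_\<epsilon> by (intro change_alternative_borel_measurable[OF elim(1) _ that]) auto
    then show ?case using borel_measurable_change_point_statistics[OF \<delta> elim(2), of "X n" M] by simp
  qed
  have diverges: "diverges_in_probability M V"
    if V_meas: "\<forall>\<^sub>F n in sequentially. V n \<in> borel_measurable M"
      and V_near: "\<And>C. AE \<omega> in N. \<exists>r>0. \<forall>\<^sub>F n in sequentially. \<forall>\<omega>'\<in>space M.
        skorokhod_dist (Z \<omega>) (scaled_partial_sums \<epsilon> n \<omega>') < r \<longrightarrow> C < V n \<omega>'" for V
    unfolding diverges_in_probability_def
  proof
    fix C
    show "(\<lambda>n. measure M {\<omega> \<in> space M. C < V n \<omega>}) \<longlonglongrightarrow> 1"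
    proof (rule skorokhod_weak_conv_imp_prob_tendsto_1[OF M N conv_Z])
      show "\<forall>\<^sub>F n in sequentially. {\<omega> \<in> space M. C < V n \<omega>} \<in> sets M"
        using V_meas by eventually_elim (simp add: borel_measurable_iff_greater)
      show "AE \<omega> in N. \<exists>r>0. \<forall>\<^sub>F n in sequentially. \<forall>\<omega>'\<in>space M.
          skorokhod_dist (Z \<omega>) (scaled_partial_sums \<epsilon> n \<omega>') < r \<longrightarrow>
          \<omega>' \<in> {\<omega> \<in> space M. C < V n \<omega>}"
        using V_near[of C] by simp
    qed
  qed
  \<comment> \<open>The three statistics share their neighbourhoods, so each inherits \<open>near\<close> from the conjunction.\<close>
  have weaken: "AE \<omega> in N. \<exists>r>0. \<forall>\<^sub>F n in sequentially. \<forall>\<omega>'\<in>space M.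
        skorokhod_dist (Z \<omega>) (scaled_partial_sums \<epsilon> n \<omega>') < r \<longrightarrow> P n \<omega>'"
    if imp: "\<And>n \<omega>'. C < V1 \<delta> n (\<lambda>k. X n k \<omega>') \<and> C < V2 \<delta> n (\<lambda>k. X n k \<omega>') \<and>
        C < V3 \<delta> n (\<lambda>k. X n k \<omega>') \<Longrightarrow> P n \<omega>'" for C P
    using near[of C]
  proof eventually_elim
    case (elim \<omega>)
    then obtain r where "0 < r" and ev: "\<forall>\<^sub>F n in sequentially. \<forall>\<omega>'\<in>space M.
      skorokhod_dist (Z \<omega>) (scaled_partial_sums \<epsilon> n \<omega>') < r \<longrightarrow>
      C < V1 \<delta> n (\<lambda>k. X n k \<omega>') \<and> C < V2 \<delta> n (\<lambda>k. X n k \<omega>') \<and> C < V3 \<delta> n (\<lambda>k. X n k \<omega>')"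
      by blast
    from ev have "\<forall>\<^sub>F n in sequentially. \<forall>\<omega>'\<in>space M.
        skorokhod_dist (Z \<omega>) (scaled_partial_sums \<epsilon> n \<omega>') < r \<longrightarrow> P n \<omega>'"
      by eventually_elim (use imp in blast)
    with \<open>0 < r\<close> show ?case by blast
  qed
  show ?thesis
    by (intro conjI diverges weaken; (blast | rule eventually_mono[OF meas]; blast))
qed

end
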